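(* Let $n\ge2$, $1\le d_1<\dots<d_s\le n-1$, and let $Q=Q(d_1,\dots,d_s)=\mathbb C[X_J]/I(d_1,\dots,d_s)$ be the (classical) coordinate ring of the partial flag variety $\mathcal F(d_1,\dots,d_s)$, where $I(d_1,\dots,d_s)$ is generated by the Plücker relations. Then the elements $X_T$, where $T$ runs over $ST^a_\lambda$ (the semistandard PBW-tableaux of shape $\lambda$) and $\lambda$ runs over $P^+(d_1,\dots,d_s)$, form a basis of $Q$ over $\mathbb C$.
   Context: $P^+(d_1,\dots,d_s)=\{m_1\omega_{d_1}+\dots+m_s\omega_{d_s}:m_i\in\mathbb Z_{\ge0}\}$, with $\omega_d$ the fundamental weights of $\mathfrak{sl}_n$. A weight $\sum_{i=1}^{n-1}m_i\omega_i$ is identified with the partition $\lambda=(m_1+\dots+m_{n-1},\,m_2+\dots+m_{n-1},\dots,m_{n-1})$ and its Young diagram $Y_\lambda$ (rows numbered top to bottom, columns left to right, box $(i,j)$ in row $i$, column $j$); $\mu_j$ is the length of the $j$-th column. A PBW-tableau of shape $\lambda$ is a filling of $Y_\lambda$ by numbers $T_{i,j}\in\{1,\dots,n\}$ such that: (1) if $T_{i,j}\le\mu_j$ then $T_{i,j}=i$; (2) if $i_1<i_2$ and $T_{i_1,j}\ne i_1$ then $T_{i_1,j}>T_{i_2,j}$. It is semistandard if moreover for every $j>1$ and every $i$ (with $(i,j)$ a box) there is $i_1\ge i$ with $T_{i_1,j-1}\ge T_{i,j}$. $ST^a_\lambda$ is the set of semistandard PBW-tableaux of shape $\lambda$. For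 a tableau $T$ of shape $\lambda$, $X_T=\prod_{j=1}^{\lambda_1}X_{T_{1,j},\dots,T_{\mu_j,j}}$. Polynomial ring: variables $X_{j_1,\dots,j_d}$ with $d\in\{d_1,\dots,d_s\}$, $1\le j_1<\dots<j_d\le n$, extended to arbitrary index sequences by being alternating in the indices (zero if an index repeats). Plücker relations: for $p\ge q$ in $\{d_1,\dots,d_s\}$, $1\le k\le q$, sequences $L=(l_1,\dots,l_p)$, $J=(j_1,\dots,j_q)$ of elements of $\{1,\dots,n\}$, and $\mathbf r=(1\le r_1<\dots<r_k\le p)$, let $L^{\mathbf r}$ be $L$ with the entry $l_{r_i}$ replaced by $j_i$ for $i=1,\dots,k$, and $J^{\mathbf r}=(l_{r_1},\dots,l_{r_k},j_{k+1},\dots,j_q)$. Then $R^{k}_{L,J}=X_LX_J-\sum_{\mathbf r}X_{L^{\mathbf r}}X_{J^{\mathbf r}}$, and $I(d_1,\dots,d_s)$ is generated by all $R^k_{L,J}$. *)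

theory Defs
  imports
    "HOL-Algebra.QuotRing"
    "HOL-Library.Poly_Mapping"
    "HOL-Library.FuncSet"
    "Jordan_Normal_Form.VS_Connect"
begin

section \<open>The polynomial ring in the Pluecker variables\<close>

text \<open>
  The variables are indexed by strictly increasing lists. A polynomial is a finitely supported
  map from monomials (finitely supported exponent vectors) to coefficients; the product of
  \<^typ>\<open>('a::monoid_add) \<Rightarrow>\<^sub>0 ('b::semiring_0)\<close> is convolution, hence the usual product of polynomials.
  The type has a variable for every list, so the ring for given \<open>n\<close> and \<open>D = {d\<^sub>1,\<dots>,d\<^sub>s}\<close>
  is cut out by its carrier.
\<close>

type_synonym pl_poly = "(nat list \<Rightarrow>\<^sub>0 nat) \<Rightarrow>\<^sub>0 complex"

definition pl_vars :: "nat \<Rightarrow> nat set \<Rightarrow> nat list set" where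
  "pl_vars n D = {J. sorted_wrt (<) J \<and> set J \<subseteq> {1..n} \<and> length J \<in> D}"

definition pl_ring :: "nat \<Rightarrow> nat set \<Rightarrow> pl_poly ring" where
  "pl_ring n D = \<lparr>carrier = {f. \<forall>m\<in>Poly_Mapping.keys f. Poly_Mapping.keys m \<subseteq> pl_vars n D},
     mult = (*), one = 1, zero = 0, add = (+)\<rparr>"

definition pl_const :: "complex \<Rightarrow> pl_poly" where
  "pl_const c = Poly_Mapping.single 0 c"

text \<open>
  The alternating extension to arbitrary index sequences: the sign of the sorting
  permutation is \<open>-1\<close> to the number of inversions.
\<close>

definition inversions :: "nat list \<Rightarrow> (nat \<times> nat) set" where
  "inversions J = {(a, b). a < b \<and> b < length J \<and> J ! b < J ! a}"

definition PX :: "nat list \<Rightarrow> pl_poly" where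
  "PX J = (if distinct J
     then (-1) ^ card (inversions J) * Poly_Mapping.single (Poly_Mapping.single (sort J) 1) 1
     else 0)"


section \<open>Pluecker relations and the coordinate ring\<close>

text \<open>
  Positions in \<open>L\<close> and \<open>J\<close> are counted from \<open>0\<close>, so \<open>r = [r\<^sub>1,\<dots>,r\<^sub>k]\<close> ranges over
  \<open>0 \<le> r\<^sub>1 < \<dots> < r\<^sub>k < p\<close>.
\<close>

definition exch_idx :: "nat \<Rightarrow> nat \<Rightarrow> nat list set" where
  "exch_idx p k = {r. sorted_wrt (<) r \<and> length r = k \<and> set r \<subseteq> {..<p}}"

definition exch_L :: "nat list \<Rightarrow> nat list \<Rightarrow> nat list \<Rightarrow> nat list" where
  "exch_L r L J = fold (\<lambda>i M. M[r ! i := J ! i]) [0..<length r] L"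

definition exch_J :: "nat list \<Rightarrow> nat list \<Rightarrow> nat list \<Rightarrow> nat list" where
  "exch_J r L J = map (\<lambda>t. L ! t) r @ drop (length r) J"

definition pl_rel :: "nat \<Rightarrow> nat list \<Rightarrow> nat list \<Rightarrow> pl_poly" where
  "pl_rel k L J = PX L * PX J
     - (\<Sum>r\<in>exch_idx (length L) k. PX (exch_L r L J) * PX (exch_J r L J))"

definition pl_rels :: "nat \<Rightarrow> nat set \<Rightarrow> pl_poly set" where
  "pl_rels n D = {pl_rel k L J | k L J.
     length L \<in> D \<and> length J \<in> D \<and> length J \<le> length L \<and> 1 \<le> k \<and> k \<le> length J \<and>
     set L \<subseteq> {1..n} \<and> set J \<subseteq> {1..n}}"

definition pl_ideal :: "nat \<Rightarrow> nat set \<Rightarrow> pl_poly set" where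
  "pl_ideal n D = Idl\<^bsub>pl_ring n D\<^esub> (pl_rels n D)"

definition pl_class :: "nat \<Rightarrow> nat set \<Rightarrow> pl_poly \<Rightarrow> pl_poly set" where
  "pl_class n D f = pl_ideal n D +>\<^bsub>pl_ring n D\<^esub> f"

text \<open>
  \<open>Q(D)\<close>: the quotient ring, with scalars acting through the constant polynomials.
\<close>

definition flag_ring :: "nat \<Rightarrow> nat set \<Rightarrow> (complex, pl_poly set) module" where
  "flag_ring n D = (let Q = pl_ring n D Quot pl_ideal n D in
     \<lparr>carrier = carrier Q, mult = mult Q, one = one Q, zero = zero Q, add = add Q,
      smult = (\<lambda>c x. pl_class n D (pl_const c) \<otimes>\<^bsub>Q\<^esub> x)\<rparr>)"


section \<open>Weights, diagrams and semistandard PBW-tableaux\<close>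

text \<open>
  The weight \<open>\<Sum>\<^sub>i m\<^sub>i \<omega>\<^sub>i\<close> is given by its coefficients \<open>m\<close>; the row
  lengths of the associated partition \<open>\<lambda>\<close> are \<open>\<lambda>\<^sub>i = part n m i\<close>. Tableaux are extensional
  functions on the boxes \<open>(i, j)\<close> (row, column), so two of them are equal iff they agree on
  every box.
\<close>

definition P_plus :: "nat set \<Rightarrow> (nat \<Rightarrow> nat) set" where
  "P_plus D = {m. \<forall>i. i \<notin> D \<longrightarrow> m i = 0}"

definition part :: "nat \<Rightarrow> (nat \<Rightarrow> nat) \<Rightarrow> nat \<Rightarrow> nat" where
  "part n m i = (\<Sum>k = i..n - 1. m k)"

definition diagram :: "nat \<Rightarrow> (nat \<Rightarrow> nat) \<Rightarrow> (nat \<times> nat) set" where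
  "diagram n m = {(i, j). i \<in> {1..n - 1} \<and> j \<in> {1..part n m i}}"

definition col_len :: "nat \<Rightarrow> (nat \<Rightarrow> nat) \<Rightarrow> nat \<Rightarrow> nat" where
  "col_len n m j = card {i. (i, j) \<in> diagram n m}"

definition PBW_tableaux :: "nat \<Rightarrow> (nat \<Rightarrow> nat) \<Rightarrow> (nat \<times> nat \<Rightarrow> nat) set" where
  "PBW_tableaux n m = {T \<in> diagram n m \<rightarrow>\<^sub>E {1..n}.
     (\<forall>i j. (i, j) \<in> diagram n m \<longrightarrow> T (i, j) \<le> col_len n m j \<longrightarrow> T (i, j) = i) \<and>
     (\<forall>i1 i2 j. (i1, j) \<in> diagram n m \<longrightarrow> (i2, j) \<in> diagram n m \<longrightarrow>
        i1 < i2 \<longrightarrow> T (i1, j) \<noteq> i1 \<longrightarrow> T (i1, j) > T (i2, j))}"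

definition semistandard_PBW :: "nat \<Rightarrow> (nat \<Rightarrow> nat) \<Rightarrow> (nat \<times> nat \<Rightarrow> nat) set" where
  "semistandard_PBW n m = {T \<in> PBW_tableaux n m.
     \<forall>i j. (i, j) \<in> diagram n m \<longrightarrow> j > 1 \<longrightarrow>
       (\<exists>i1\<ge>i. (i1, j - 1) \<in> diagram n m \<and> T (i1, j - 1) \<ge> T (i, j))}"

definition column :: "nat \<Rightarrow> (nat \<Rightarrow> nat) \<Rightarrow> (nat \<times> nat \<Rightarrow> nat) \<Rightarrow> nat \<Rightarrow> nat list" where
  "column n m T j = map (\<lambda>i. T (i, j)) [1..<Suc (col_len n m j)]"

definition X_tab :: "nat \<Rightarrow> (nat \<Rightarrow> nat) \<Rightarrow> (nat \<times> nat \<Rightarrow> nat) \<Rightarrow> pl_poly" where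
  "X_tab n m T = (\<Prod>j = 1..part n m 1. PX (column n m T j))"


section \<open>Well-definedness\<close>

text \<open>
  \<open>Idl\<close> is meaningful only for subsets of the carrier of a ring, and
  \<open>vectorspace.basis\<close> only for a vector space. Both are checked here.
\<close>

lemma pl_ring_simps:
  "mult (pl_ring n D) = (*)" "one (pl_ring n D) = 1"
  "zero (pl_ring n D) = 0" "add (pl_ring n D) = (+)"
  by (simp_all add: pl_ring_def)

lemma pl_carrier_iff:
  "f \<in> carrier (pl_ring n D) \<longleftrightarrow>
     (\<forall>m\<in>Poly_Mapping.keys f. Poly_Mapping.keys m \<subseteq> pl_vars n D)"
  by (simp add: pl_ring_def)

lemma pl_add_closed:
  "f \<in> carrier (pl_ring n D) \<Longrightarrow> g \<in> carrier (pl_ring n D) \<Longrightarrow> f + g \<in> carrier (pl_ring n D)"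
  unfolding pl_carrier_iff using Poly_Mapping.keys_add[of f g] by blast

lemma pl_uminus_closed:
  "f \<in> carrier (pl_ring n D) \<Longrightarrow> - f \<in> carrier (pl_ring n D)"
  by (simp add: pl_carrier_iff)

lemma pl_mult_closed:
  assumes "f \<in> carrier (pl_ring n D)" "g \<in> carrier (pl_ring n D)"
  shows "f * g \<in> carrier (pl_ring n D)"
  unfolding pl_carrier_iff
proof
  fix m assume "m \<in> Poly_Mapping.keys (f * g)"
  then obtain a b where "m = a + b" "a \<in> Poly_Mapping.keys f" "b \<in> Poly_Mapping.keys g"
    using keys_mult[of f g] by blast
  then show "Poly_Mapping.keys m \<subseteq> pl_vars n D"
    using assms Poly_Mapping.keys_add[of a b] unfolding pl_carrier_iff by blast
qed

lemma pl_const_closed: "pl_const c \<in> carrier (pl_ring n D)"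
  by (simp add: pl_carrier_iff pl_const_def)

lemma pl_one_closed: "1 \<in> carrier (pl_ring n D)"
  using pl_const_closed[of 1 n D] by (simp add: pl_const_def)

lemma pl_zero_closed: "0 \<in> carrier (pl_ring n D)"
  by (simp add: pl_carrier_iff)

lemma pl_sum_closed:
  "(\<And>x. x \<in> A \<Longrightarrow> f x \<in> carrier (pl_ring n D)) \<Longrightarrow> sum f A \<in> carrier (pl_ring n D)"
  by (induction A rule: infinite_finite_induct) (auto simp: pl_zero_closed intro: pl_add_closed)

lemma pl_prod_closed:
  "(\<And>x. x \<in> A \<Longrightarrow> f x \<in> carrier (pl_ring n D)) \<Longrightarrow> prod f A \<in> carrier (pl_ring n D)"
  by (induction A rule: infinite_finite_induct) (auto simp: pl_one_closed intro: pl_mult_closed)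

lemma pl_ring_cring: "cring (pl_ring n D)"
proof (rule cringI)
  show "abelian_group (pl_ring n D)"
  proof (rule abelian_groupI)
    fix x assume x: "x \<in> carrier (pl_ring n D)"
    show "\<exists>y\<in>carrier (pl_ring n D). y \<oplus>\<^bsub>pl_ring n D\<^esub> x = \<zero>\<^bsub>pl_ring n D\<^esub>"
      by (rule bexI[of _ "- x"]) (simp_all add: pl_ring_simps pl_uminus_closed x)
  qed (auto simp: pl_ring_simps pl_zero_closed algebra_simps intro: pl_add_closed)
  show "Group.comm_monoid (pl_ring n D)"
    by (rule comm_monoidI)
       (auto simp: pl_ring_simps pl_one_closed algebra_simps intro: pl_mult_closed)
qed (auto simp: pl_ring_simps algebra_simps)

lemma PX_closed:
  assumes "set J \<subseteq> {1..n}" "length J \<in> D"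
  shows "PX J \<in> carrier (pl_ring n D)"
proof (cases "distinct J")
  case True
  then have "sort J \<in> pl_vars n D"
    using assms by (simp add: pl_vars_def strict_sorted_iff)
  then have v: "Poly_Mapping.single (Poly_Mapping.single (sort J) 1) 1 \<in> carrier (pl_ring n D)"
    by (simp add: pl_carrier_iff)
  have "(-1) ^ k \<in> carrier (pl_ring n D)" for k
    by (induction k) (auto simp: pl_one_closed intro: pl_uminus_closed)
  then show ?thesis
    using True v by (simp add: PX_def pl_mult_closed)
qed (simp add: PX_def pl_zero_closed)

lemma exch_L_aux:
  assumes "\<And>i. i \<in> set is \<Longrightarrow> i < length J"
  shows "length (fold (\<lambda>i M. M[r ! i := J ! i]) is L) = length L \<and>
    set (fold (\<lambda>i M. M[r ! i := J ! i]) is L) \<subseteq> set L \<union> set J"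
  using assms
proof (induction "is" arbitrary: L)
  case (Cons a xs)
  have "set (L[r ! a := J ! a]) \<subseteq> set L \<union> set J"
    using set_update_subset_insert[of L "r ! a" "J ! a"] Cons.prems[of a] by auto
  then show ?case
    using Cons.IH[of "L[r ! a := J ! a]"] Cons.prems by fastforce
qed simp

lemma pl_rels_carrier: "pl_rels n D \<subseteq> carrier (pl_ring n D)"
proof
  fix f assume "f \<in> pl_rels n D"
  then obtain k L J where f: "f = pl_rel k L J"
    and LJ: "length L \<in> D" "length J \<in> D" "k \<le> length J"
      "set L \<subseteq> {1..n}" "set J \<subseteq> {1..n}"
    unfolding pl_rels_def by blast
  have summand: "PX (exch_L r L J) * PX (exch_J r L J) \<in> carrier (pl_ring n D)"
    if "r \<in> exch_idx (length L) k" for r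
  proof -
    have r: "length r = k" "set r \<subseteq> {..<length L}"
      using that by (auto simp: exch_idx_def)
    have "length (exch_L r L J) = length L \<and> set (exch_L r L J) \<subseteq> set L \<union> set J"
      unfolding exch_L_def by (rule exch_L_aux) (use r LJ in auto)
    moreover have "length (exch_J r L J) = length J"
      using r LJ by (simp add: exch_J_def)
    moreover have "set (exch_J r L J) \<subseteq> set L \<union> set J"
      using r set_drop_subset[of k J] by (auto simp: exch_J_def)
    ultimately show ?thesis
      using LJ by (intro pl_mult_closed PX_closed) auto
  qed
  have LJ': "PX L * PX J \<in> carrier (pl_ring n D)"
    using LJ by (intro pl_mult_closed PX_closed)
  have "PX L * PX J +
      - (\<Sum>r\<in>exch_idx (length L) k. PX (exch_L r L J) * PX (exch_J r L J)) \<in> carrier (pl_ring n D)"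
    by (rule pl_add_closed[OF LJ' pl_uminus_closed[OF pl_sum_closed[OF summand]]])
  then show "f \<in> carrier (pl_ring n D)"
    by (simp add: f pl_rel_def)
qed

lemma pl_ideal_ideal: "ideal (pl_ideal n D) (pl_ring n D)"
  unfolding pl_ideal_def
  by (rule ring.genideal_ideal[OF cring.axioms(1)[OF pl_ring_cring] pl_rels_carrier])

lemma pl_Quot_cring: "cring (pl_ring n D Quot pl_ideal n D)"
  by (rule ideal.quotient_is_cring[OF pl_ideal_ideal pl_ring_cring])

lemma flag_ring_algebra: "algebra (class_ring :: complex ring) (flag_ring n D)"
proof -
  let ?R = "pl_ring n D"
  let ?Q = "pl_ring n D Quot pl_ideal n D"
  interpret I: ideal "pl_ideal n D" ?R by (rule pl_ideal_ideal)
  interpret Q: cring ?Q by (rule pl_Quot_cring)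
  have hom: "ring_hom_ring ?R ?Q (\<lambda>f. pl_ideal n D +>\<^bsub>?R\<^esub> f)"
    by (rule I.rcos_ring_hom_ring)
  interpret h: ring_hom_ring ?R ?Q "\<lambda>f. pl_ideal n D +>\<^bsub>?R\<^esub> f" by (rule hom)
  let ?s = "\<lambda>c. pl_class n D (pl_const c)"
  have sc: "?s c \<in> carrier ?Q" for c
    unfolding pl_class_def by (rule h.hom_closed[OF pl_const_closed])
  have sadd: "?s (a + b) = ?s a \<oplus>\<^bsub>?Q\<^esub> ?s b" for a b
    using h.hom_add[OF pl_const_closed pl_const_closed, of a b]
    by (simp add: pl_class_def pl_ring_simps pl_const_def single_add)
  have smult: "?s (a * b) = ?s a \<otimes>\<^bsub>?Q\<^esub> ?s b" for a b
    using h.hom_mult[OF pl_const_closed pl_const_closed, of a b]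
    by (simp add: pl_class_def pl_ring_simps pl_const_def mult_single)
  have sone: "?s 1 = \<one>\<^bsub>?Q\<^esub>"
    using h.hom_one by (simp add: pl_class_def pl_ring_simps pl_const_def)
  have F: "carrier (flag_ring n D) = carrier ?Q" "mult (flag_ring n D) = mult ?Q"
    "one (flag_ring n D) = one ?Q" "zero (flag_ring n D) = zero ?Q"
    "add (flag_ring n D) = add ?Q" "smult (flag_ring n D) = (\<lambda>c x. ?s c \<otimes>\<^bsub>?Q\<^esub> x)"
    by (simp_all add: flag_ring_def Let_def)
  have cr: "cring (flag_ring n D)"
  proof (rule cringI)
    show "abelian_group (flag_ring n D)"
      by (rule abelian_groupI) (auto simp: F Q.a_ac intro: Q.l_neg)
    show "Group.comm_monoid (flag_ring n D)"
      by (rule comm_monoidI) (auto simp: F Q.m_ac)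
  qed (auto simp: F Q.l_distr)
  show ?thesis
  proof (rule algebraI)
    show "cring (class_ring :: complex ring)"
      using class_field field.axioms(1) domain.axioms(1) by blast
    show "cring (flag_ring n D)" by (rule cr)
  qed (auto simp: F sc sadd smult sone Q.l_distr Q.r_distr Q.m_assoc)
qed

lemma flag_ring_vectorspace: "vectorspace (class_ring :: complex ring) (flag_ring n D)"
  unfolding vectorspace_def
  using flag_ring_algebra[of n D] class_field algebra.module by blast

lemma pl_class_closed:
  "f \<in> carrier (pl_ring n D) \<Longrightarrow> pl_class n D f \<in> carrier (flag_ring n D)"
  unfolding pl_class_def flag_ring_def Let_def
  by (simp add: ring_hom_closed[OF ideal.rcos_ring_hom[OF pl_ideal_ideal]])

end

theory Submission
  imports Defs "Jordan_Normal_Form.Char_Poly"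
begin

text \<open>
  Sending \<open>X\<^sub>J\<close> to the minor of a generic upper triangular matrix \<open>z\<close> on its first rows and the columns
  \<open>J\<close> kills the Pluecker relations. Give \<open>z\<^sub>i\<^sub>j\<close> the weight \<open>i j\<close>: by the rearrangement inequality the
  minor of a PBW column \<open>T\<close> then has the single term \<open>\<Prod>\<^sub>i z\<^sub>i\<^sub>,\<^sub>T\<^sub>i\<close> of lowest weight. Hence the lowest term
  of \<open>X\<^sub>T\<close> records the contents of the rows of \<open>T\<close>, and a semistandard PBW-tableau is determined
  by them. This gives linear independence.

  By the classical straightening law the ordinary semistandard tableaux of shape \<open>\<lambda>\<close> span the weight
  space of \<open>\<lambda>\<close>. Replacing the entries \<open>s\<^sub>i\<close> of a strictly increasing column by \<open>n + i - s\<^sub>i\<close> yields the suffix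
  maxima of a PBW column, and this turns semistandard tableaux into semistandard PBW-tableaux. So
  there are at least as many of the latter as the dimension of the weight space, and being linearly
  independent they span it by Steinitz exchange.
\<close>


section \<open>Alternating functions and determinants\<close>

text \<open>Upper triangularity is what makes the weight \<open>i j\<close> select PBW columns. For
  a full generic matrix the rearrangement inequality prefers entries that decrease down the column:
  for the entries 1 and 3 it picks \<open>z_{1,3} z_{2,1}\<close> of weight 5 over
  \<open>z_{1,1} z_{2,3}\<close> of weight 7, while the PBW column is (1, 3). The vanishing of
  \<open>z_{2,1}\<close> removes the competitor.

  The ideal is given by generators and might a priori be smaller than the kernel of the evaluation
  at minors. Evaluation can therefore prove independence only; spanning has to come from the
  relations themselves.

  The formula \<open>n + i - s_i\<close> arises because semistandardness of PBW-tableaux sees a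
  column only through its suffix maxima, which must weakly decrease from left to right. In a column
  of length \<open>d\<close> they form a weakly decreasing sequence with values from
  \<open>d\<close> to \<open>n\<close>. Reversing the order and adding a staircase makes it a
  strictly increasing sequence with values from 1 to \<open>n\<close>.\<close>

lemma finite_inversions: "finite (inversions J)"
  by (rule finite_subset[of _ "{..<length J} \<times> {..<length J}"]) (auto simp: inversions_def)

lemma inversions_Cons:
  "card (inversions (x # xs)) = length (filter (\<lambda>y. y < x) xs) + card (inversions xs)"
proof -
  let ?A = "(\<lambda>b. (0, Suc b)) ` {b. b < length xs \<and> xs ! b < x}"
  let ?B = "map_prod Suc Suc ` inversions xs"
  have "inversions (x # xs) = ?A \<union> ?B"
  proof (intro equalityI subsetI)
    fix z assume "z \<in> inversions (x # xs)"
    then obtain a b where z: "z = (a, b)" "a < b" "b < Suc (length xs)" "(x # xs) ! b < (x # xs) ! a"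
      by (auto simp: inversions_def)
    then obtain b' where b': "b = Suc b'" by (cases b) auto
    show "z \<in> ?A \<union> ?B"
    proof (cases a)
      case 0 then show ?thesis using z b' by auto
    next
      case (Suc a')
      then have "(a', b') \<in> inversions xs" using z b' by (auto simp: inversions_def)
      then show ?thesis using z b' Suc by force
    qed
  qed (auto simp: inversions_def)
  moreover have "?A \<inter> ?B = {}" by auto
  moreover have "card ?A = length (filter (\<lambda>y. y < x) xs)"
    by (subst card_image) (auto simp: inj_on_def length_filter_conv_card)
  moreover have "card ?B = card (inversions xs)"
    by (rule card_image) (auto simp: inj_on_def)
  ultimately show ?thesis
    by (simp add: card_Un_disjoint finite_inversions)
qed

text \<open>An entry in front has the same number of smaller entries behind it before and after the
  swap, so only the swapped pair makes a difference.\<close>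

lemma inversions_swap:
  assumes "b < a"
  shows "card (inversions (xs @ a # b # ys)) = Suc (card (inversions (xs @ b # a # ys)))"
  using assms by (induction xs) (auto simp: inversions_Cons)

lemma inversions_sorted: "sorted J \<Longrightarrow> inversions J = {}"
  using sorted_nth_mono[of J] by (auto simp: inversions_def not_less[symmetric])

text \<open>Bubble sort: swapping an adjacent strict descent removes exactly one inversion and
  contributes one sign. Lists with repeated entries are covered, since equal neighbours are never
  swapped.\<close>

lemma alternating_sort:
  fixes G :: "nat list \<Rightarrow> 'a::comm_ring_1"
  assumes swap: "\<And>xs a b ys. length xs + length ys + 2 = k \<Longrightarrow> G (xs @ a # b # ys) = - G (xs @ b # a # ys)"
  assumes "length t = k"
  shows "G t = (-1) ^ card (inversions t) * G (sort t)"
  using \<open>length t = k\<close>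
proof (induction "card (inversions t)" arbitrary: t rule: less_induct)
  case less
  show ?case
  proof (cases "sorted t")
    case True
    then show ?thesis by (simp add: inversions_sorted sorted_sort_id)
  next
    case False
    then obtain i where i: "Suc i < length t" "t ! Suc i < t ! i"
      unfolding sorted_iff_nth_Suc by (auto simp: not_le)
    define xs ys where "xs = take i t" and "ys = drop (Suc (Suc i)) t"
    have t: "t = xs @ t ! i # t ! Suc i # ys"
      using i by (simp add: xs_def ys_def Cons_nth_drop_Suc id_take_nth_drop[symmetric])
    define t' where "t' = xs @ t ! Suc i # t ! i # ys"
    have inv: "card (inversions t) = Suc (card (inversions t'))"
      by (subst t, subst inversions_swap) (use i in \<open>auto simp: t'_def\<close>)
    have "length t' = length t" using arg_cong[OF t, of length] by (simp add: t'_def)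
    then have IH: "G t' = (-1) ^ card (inversions t') * G (sort t')"
      using less.hyps[of t'] less.prems inv by simp
    have "mset t = mset t'" using arg_cong[OF t, of mset] by (simp add: t'_def)
    then have "sort t' = sort t" using properties_for_sort[of "sort t" t'] by simp
    moreover have "G t = - G t'"
      by (subst t, unfold t'_def, rule swap) (use i less.prems in \<open>auto simp: xs_def ys_def\<close>)
    ultimately show ?thesis using IH inv by simp
  qed
qed

section \<open>Determinants as multilinear alternating functions of lists of vectors\<close>

text \<open>The vectors are unbounded functions, and the length of the list decides how many
  coordinates count. So the same vectors enter determinants of different sizes, like the columns of
  a matrix in minors on its first rows, and replacing a vector is a list update.\<close>

definition vdet :: "(nat \<Rightarrow> 'a::comm_ring_1) list \<Rightarrow> 'a" where
  "vdet V = det (mat (length V) (length V) (\<lambda>(i, j). (V ! i) j))"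

lemma vdet_swap:
  assumes "i < length V" "j < length V" "i \<noteq> j"
  shows "vdet (V[i := V ! j, j := V ! i]) = - vdet V"
proof -
  let ?A = "mat (length V) (length V) (\<lambda>(i, j). (V ! i) j)"
  have "vdet (V[i := V ! j, j := V ! i]) = det (swaprows i j ?A)"
    unfolding vdet_def
    by (rule arg_cong[of _ _ det], rule eq_matI) (use assms in \<open>auto simp: nth_list_update\<close>)
  also have "\<dots> = - vdet V"
    unfolding vdet_def by (rule det_swaprows) (use assms in auto)
  finally show ?thesis .
qed

lemma vdet_repeat:
  assumes "i < length V" "j < length V" "i \<noteq> j" "V ! i = V ! j"
  shows "vdet V = 0"
  unfolding vdet_def
  by (rule det_identical_rows[of _ "length V" i j]) (use assms in \<open>auto intro!: eq_vecI\<close>)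

text \<open>The factor \<open>d\<close> is there for Cramer's rule, which expresses a multiple of
  \<open>w\<close> as a combination. The identity is asked only for the coordinates that
  \<open>vdet\<close> reads.\<close>

lemma vdet_linear:
  assumes k: "k < length V" and w: "\<And>j. j < length V \<Longrightarrow> d * w j = (\<Sum>t\<in>S. c t * L t j)"
  shows "d * vdet (V[k := w]) = (\<Sum>t\<in>S. c t * vdet (V[k := L t]))"
proof -
  let ?n = "length V"
  let ?R = "\<lambda>p. \<Prod>i\<in>{0..<?n} - {k}. (V ! i) (p i)"
  have expand: "vdet (V[k := u]) = (\<Sum>p | p permutes {0..<?n}. signof p * (u (p k) * ?R p))" for u
  proof -
    have "vdet (V[k := u]) = (\<Sum>p | p permutes {0..<?n}. signof p * (\<Prod>i = 0..<?n. (V[k := u] ! i) (p i)))"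
      unfolding vdet_def det_def by (auto intro!: sum.cong prod.cong simp: permutes_in_image)
    also have "\<dots> = (\<Sum>p | p permutes {0..<?n}. signof p * (u (p k) * ?R p))"
    proof (rule sum.cong[OF refl])
      fix p
      have "(\<Prod>i = 0..<?n. (V[k := u] ! i) (p i)) = u (p k) * (\<Prod>i\<in>{0..<?n} - {k}. (V[k := u] ! i) (p i))"
        using k by (subst prod.remove[of _ k]) auto
      also have "(\<Prod>i\<in>{0..<?n} - {k}. (V[k := u] ! i) (p i)) = ?R p"
        by (rule prod.cong) auto
      finally show "signof p * (\<Prod>i = 0..<?n. (V[k := u] ! i) (p i)) = signof p * (u (p k) * ?R p)"
        by simp
    qed
    finally show ?thesis .
  qed
  have "d * vdet (V[k := w]) = (\<Sum>p | p permutes {0..<?n}. signof p * (d * w (p k) * ?R p))"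
    unfolding expand sum_distrib_left by (rule sum.cong) (auto simp: algebra_simps)
  also have "\<dots> = (\<Sum>p | p permutes {0..<?n}. \<Sum>t\<in>S. c t * (signof p * (L t (p k) * ?R p)))"
  proof (rule sum.cong[OF refl])
    fix p assume "p \<in> {p. p permutes {0..<?n}}"
    then have "p k < ?n" using k permutes_in_image[of p "{0..<?n}" k] by auto
    from w[OF this] show "signof p * (d * w (p k) * ?R p) = (\<Sum>t\<in>S. c t * (signof p * (L t (p k) * ?R p)))"
      by (simp add: sum_distrib_left sum_distrib_right algebra_simps)
  qed
  also have "\<dots> = (\<Sum>t\<in>S. c t * vdet (V[k := L t]))"
    unfolding expand sum_distrib_left by (rule sum.swap)
  finally show ?thesis .
qed

lemma (in comm_ring_hom) hom_vdet: "hom (vdet V) = vdet (map (\<lambda>v. hom \<circ> v) V)"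
  unfolding vdet_def hom_det[symmetric]
  by (rule arg_cong[of _ _ det], rule eq_matI) auto

text \<open>The exchange of \<open>exch_L\<close> for entries of any type, so that it applies to
  vectors as well as to their indices.\<close>

definition exch :: "nat list \<Rightarrow> 'a list \<Rightarrow> 'a list \<Rightarrow> 'a list" where
  "exch r L J = fold (\<lambda>i M. M[r ! i := J ! i]) [0..<length r] L"

lemma exch_L_eq: "exch_L r L J = exch r L J"
  by (simp add: exch_L_def exch_def)

lemma exch_fold_length: "length (fold (\<lambda>i M. M[r ! i := J ! i]) is L) = length L"
  by (induction "is" arbitrary: L) auto

lemma length_exch [simp]: "length (exch r L J) = length L"
  by (simp add: exch_def exch_fold_length)

lemma nth_exch:
  assumes "b < length L" "distinct r"
  shows "exch r L J ! b = (if b \<in> set r then J ! (THE i. i < length r \<and> r ! i = b) else L ! b)"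
proof -
  have *: "fold (\<lambda>i M. M[r ! i := J ! i]) [0..<k] L ! b
      = (if \<exists>i<k. r ! i = b then J ! (THE i. i < length r \<and> r ! i = b) else L ! b)"
    if "k \<le> length r" for k
    using that
  proof (induction k)
    case (Suc k)
    let ?M = "fold (\<lambda>i M. M[r ! i := J ! i]) [0..<k] L"
    have "length ?M = length L" by (rule exch_fold_length)
    moreover have "(THE i. i < length r \<and> r ! i = b) = k" if "r ! k = b"
      using Suc.prems that assms(2) by (intro the_equality) (auto simp: nth_eq_iff_index_eq)
    ultimately show ?case
      using Suc assms(1) by (cases "r ! k = b") (auto simp: less_Suc_eq)
  qed simp
  from *[of "length r"] show ?thesis
    by (auto simp: exch_def in_set_conv_nth)
qed

lemma nth_exch_in:
  assumes "i < length r" "distinct r" "r ! i < length L"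
  shows "exch r L J ! (r ! i) = J ! i"
proof -
  have "(THE i'. i' < length r \<and> r ! i' = r ! i) = i"
    using assms by (intro the_equality) (auto simp: nth_eq_iff_index_eq)
  then show ?thesis using assms by (simp add: nth_exch)
qed

lemma nth_exch_notin:
  "b < length L \<Longrightarrow> distinct r \<Longrightarrow> b \<notin> set r \<Longrightarrow> exch r L J ! b = L ! b"
  by (simp add: nth_exch)

text \<open>Slot \<open>i\<close> of the inserted list is row \<open>r ! i\<close> of the result;
  this is why the determinant of \<open>exch r L J\<close> is multilinear and alternating in
  \<open>J\<close>.\<close>

lemma exch_update:
  assumes "i < length r" "distinct r" "set r \<subseteq> {..<length L}" "length J = length r"
  shows "exch r L (J[i := w]) = (exch r L J)[r ! i := w]"
proof (rule nth_equalityI)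
  fix b assume b: "b < length (exch r L (J[i := w]))"
  show "exch r L (J[i := w]) ! b = (exch r L J)[r ! i := w] ! b"
  proof (cases "b \<in> set r")
    case True
    then obtain a where a: "a < length r" "b = r ! a" by (auto simp: in_set_conv_nth)
    have "exch r L (J[i := w]) ! b = J[i := w] ! a" "exch r L J ! b = J ! a"
      using a assms b by (simp_all add: nth_exch_in)
    moreover have "r ! i = b \<longleftrightarrow> i = a"
      using a assms by (simp add: nth_eq_iff_index_eq)
    ultimately show ?thesis using assms a b by (simp add: nth_list_update)
  next
    case False
    then have "r ! i \<noteq> b" using assms by auto
    with False assms b show ?thesis by (simp add: nth_exch_notin)
  qed
qed simp

lemma map_exch: "length r \<le> length J \<Longrightarrow>
  map f (exch r L J) = exch r (map f L) (map f J)"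
proof -
  assume "length r \<le> length J"
  have "map f (fold (\<lambda>i M. M[r ! i := J ! i]) is L) =
      fold (\<lambda>i M. M[r ! i := map f J ! i]) is (map f L)" if "set is \<subseteq> {..<length J}" for "is"
    using that by (induction "is" arbitrary: L) (auto simp: map_update)
  from this[of "[0..<length r]"] \<open>length r \<le> length J\<close> show ?thesis
    by (simp add: exch_def subset_eq)
qed

section \<open>Pluecker relations for minors\<close>

lemma lists_length_Suc:
  "{t. length t = Suc j \<and> set t \<subseteq> S} = (\<lambda>(t, s). t @ [s]) ` ({t. length t = j \<and> set t \<subseteq> S} \<times> S)"
proof (intro equalityI subsetI)
  fix t assume "t \<in> {t. length t = Suc j \<and> set t \<subseteq> S}"
  moreover from this have "t \<noteq> []" by auto
  ultimately have "t = (\<lambda>(t, s). t @ [s]) (butlast t, last t)" "length (butlast t) = j"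
    "set (butlast t) \<subseteq> S" "last t \<in> S"
    using last_in_set[of t] by (auto dest: in_set_butlastD)
  then show "t \<in> (\<lambda>(t, s). t @ [s]) ` ({t. length t = j \<and> set t \<subseteq> S} \<times> S)" by blast
qed auto

text \<open>The slots of \<open>W\<close> are expanded one after another from the left, each at the
  cost of a factor \<open>d\<close>. In \<open>lin\<close> the list \<open>V\<close> is arbitrary
  because the other slots hold vectors that are already expanded or still untouched.\<close>

lemma multilinear_expand:
  fixes F :: "'v list \<Rightarrow> 'a::comm_ring_1"
  assumes lin: "\<And>V i. length V = k \<Longrightarrow> i < k \<Longrightarrow> d * F (V[i := W ! i]) = (\<Sum>t<p. c i t * F (V[i := L ! t]))"
    and W: "length W = k"
  shows "d ^ k * F W = (\<Sum>t | length t = k \<and> set t \<subseteq> {..<p}. (\<Prod>i<k. c i (t ! i)) * F (map ((!) L) t))"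
proof -
  have "d ^ j * F W = (\<Sum>t | length t = j \<and> set t \<subseteq> {..<p}. (\<Prod>i<j. c i (t ! i)) * F (map ((!) L) t @ drop j W))"
    if "j \<le> k" for j
    using that
  proof (induction j)
    case 0
    have "{t. length t = 0 \<and> set t \<subseteq> {..<p}} = {[]}" by auto
    then show ?case by simp
  next
    case (Suc j)
    let ?T = "{t. length t = j \<and> set t \<subseteq> {..<p}}"
    have fin: "finite ?T" using finite_lists_length_eq[of "{..<p}" j] by (simp add: conj_commute)
    have "d ^ Suc j * F W = (\<Sum>t\<in>?T. (\<Prod>i<j. c i (t ! i)) * (d * F (map ((!) L) t @ drop j W)))"
      using Suc by (simp add: sum_distrib_left mult.assoc mult.left_commute)
    also have "\<dots> = (\<Sum>t\<in>?T. \<Sum>s<p. (\<Prod>i<Suc j. c i ((t @ [s]) ! i)) * F (map ((!) L) (t @ [s]) @ drop (Suc j) W))"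
    proof (rule sum.cong[OF refl])
      fix t assume t: "t \<in> ?T"
      let ?V = "map ((!) L) t @ drop j W"
      have upd: "?V[j := w] = map ((!) L) t @ w # drop (Suc j) W" for w
        using t Suc.prems W by (simp add: list_update_append Cons_nth_drop_Suc[symmetric])
      have "?V[j := W ! j] = ?V"
        unfolding upd using Suc.prems W by (simp add: Cons_nth_drop_Suc)
      then have "d * F ?V = (\<Sum>s<p. c j s * F (map ((!) L) t @ L ! s # drop (Suc j) W))"
        using lin[of ?V j] t Suc.prems W by (simp add: upd)
      moreover have "(\<Prod>i<Suc j. c i ((t @ [s]) ! i)) = (\<Prod>i<j. c i (t ! i)) * c j s" for s
        using t by (simp add: nth_append)
      ultimately show "(\<Prod>i<j. c i (t ! i)) * (d * F ?V) = (\<Sum>s<p. (\<Prod>i<Suc j. c i ((t @ [s]) ! i)) * F (map ((!) L) (t @ [s]) @ drop (Suc j) W))"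
        by (simp add: sum_distrib_left mult.assoc)
    qed
    also have "\<dots> = (\<Sum>t | length t = Suc j \<and> set t \<subseteq> {..<p}. (\<Prod>i<Suc j. c i (t ! i)) * F (map ((!) L) t @ drop (Suc j) W))"
      unfolding lists_length_Suc
      by (subst sum.reindex) (auto simp: inj_on_def sum.cartesian_product split_def intro!: sum.cong)
    finally show ?case .
  qed
  from this[of k] W show ?thesis by simp
qed

lemma finite_exch_idx: "finite (exch_idx p k)"
  by (rule finite_subset[OF _ finite_lists_length_eq[of "{..<p}" k]]) (auto simp: exch_idx_def)

lemma distinct_exch_idx: "r \<in> exch_idx p k \<Longrightarrow> distinct r"
  by (simp add: exch_idx_def strict_sorted_iff)

text \<open>For strictly increasing \<open>r\<close> of length \<open>k\<close> this is the Leibniz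
  expansion of the \<open>k\<close> by \<open>k\<close> minor of the matrix \<open>c\<close> on the
  columns \<open>r\<close>.\<close>

definition exch_coeff :: "nat \<Rightarrow> (nat \<Rightarrow> nat \<Rightarrow> 'a::comm_ring_1) \<Rightarrow> nat list \<Rightarrow> 'a" where
  "exch_coeff k c r = (\<Sum>t | length t = k \<and> distinct t \<and> sort t = r. (-1) ^ card (inversions t) * (\<Prod>i<k. c i (t ! i)))"

text \<open>Lists with a repeated index drop out, and the others are grouped by their sorted
  version. The coefficients depend on \<open>c\<close> and not on \<open>F\<close>, so the
  expansions of different functions can be compared.\<close>

lemma alternating_expand:
  fixes F :: "'v list \<Rightarrow> 'a::comm_ring_1"
  assumes lin: "\<And>V i. length V = k \<Longrightarrow> i < k \<Longrightarrow> d * F (V[i := W ! i]) = (\<Sum>t<p. c i t * F (V[i := L ! t]))"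
    and W: "length W = k"
    and swap: "\<And>V i j. length V = k \<Longrightarrow> i < k \<Longrightarrow> j < k \<Longrightarrow> i \<noteq> j \<Longrightarrow> F (V[i := V ! j, j := V ! i]) = - F V"
    and rep: "\<And>V i j. length V = k \<Longrightarrow> i < k \<Longrightarrow> j < k \<Longrightarrow> i \<noteq> j \<Longrightarrow> V ! i = V ! j \<Longrightarrow> F V = 0"
  shows "d ^ k * F W = (\<Sum>r\<in>exch_idx p k. exch_coeff k c r * F (map ((!) L) r))"
proof -
  let ?T = "{t. length t = k \<and> set t \<subseteq> {..<p}}"
  let ?D = "{t. length t = k \<and> distinct t \<and> set t \<subseteq> {..<p}}"
  define G where "G t = F (map ((!) L) t)" for t
  have finT: "finite ?T" using finite_lists_length_eq[of "{..<p}" k] by (simp add: conj_commute)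
  have G0: "G t = 0" if t: "length t = k" "\<not> distinct t" for t
  proof -
    obtain i j where "i < k" "j < k" "i \<noteq> j" "t ! i = t ! j"
      using t by (auto simp: distinct_conv_nth)
    then show ?thesis using rep[of "map ((!) L) t" i j] t by (simp add: G_def)
  qed
  have Gs: "G t = (-1) ^ card (inversions t) * G (sort t)" if "length t = k" for t
  proof (rule alternating_sort[OF _ that])
    fix xs ys :: "nat list" and a b
    assume l: "length xs + length ys + 2 = k"
    let ?V = "map ((!) L) (xs @ b # a # ys)" and ?i = "length xs"
    have "?V[?i := ?V ! Suc ?i, Suc ?i := ?V ! ?i] = map ((!) L) (xs @ a # b # ys)"
      by (simp add: list_update_append nth_append)
    then show "G (xs @ a # b # ys) = - G (xs @ b # a # ys)"
      using swap[of ?V ?i "Suc ?i"] l by (simp add: G_def)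
  qed
  have "d ^ k * F W = (\<Sum>t\<in>?T. (\<Prod>i<k. c i (t ! i)) * G t)"
    unfolding G_def by (rule multilinear_expand[OF lin W])
  also have "\<dots> = (\<Sum>t\<in>?D. (\<Prod>i<k. c i (t ! i)) * G t)"
    by (rule sum.mono_neutral_right[OF finT]) (use G0 in force)+
  also have "\<dots> = (\<Sum>r\<in>exch_idx p k. \<Sum>t\<in>{t\<in>?D. sort t = r}. (\<Prod>i<k. c i (t ! i)) * G t)"
    by (rule sum.group[symmetric, OF finite_subset[OF _ finT] finite_exch_idx])
       (auto simp: exch_idx_def strict_sorted_iff)
  also have "\<dots> = (\<Sum>r\<in>exch_idx p k. exch_coeff k c r * G r)"
  proof (rule sum.cong[OF refl])
    fix r assume r: "r \<in> exch_idx p k"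
    have "set t \<subseteq> {..<p}" if "sort t = r" for t
      using r that[symmetric] by (auto simp: exch_idx_def)
    then have "{t\<in>?D. sort t = r} = {t. length t = k \<and> distinct t \<and> sort t = r}" by auto
    moreover have "(\<Prod>i<k. c i (t ! i)) * G t = ((-1) ^ card (inversions t) * (\<Prod>i<k. c i (t ! i))) * G r"
      if "length t = k" "sort t = r" for t
      using Gs[OF that(1)] that(2) by simp
    ultimately show "(\<Sum>t\<in>{t\<in>?D. sort t = r}. (\<Prod>i<k. c i (t ! i)) * G t) = exch_coeff k c r * G r"
      unfolding exch_coeff_def sum_distrib_right by (auto intro!: sum.cong)
  qed
  finally show ?thesis unfolding G_def .
qed

text \<open>With \<open>A\<close> the matrix of \<open>L\<close>, the coefficients are the entries
  of \<open>v\<close> times the adjugate of \<open>A\<close>: the adjugate times \<open>A\<close> is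
  the determinant times the identity, over any commutative ring.\<close>

lemma cramer_vdet:
  fixes L :: "(nat \<Rightarrow> 'a::comm_ring_1) list"
  shows "\<exists>c. \<forall>j<length L. vdet L * v j = (\<Sum>t<length L. c t * (L ! t) j)"
proof -
  let ?p = "length L"
  let ?A = "mat ?p ?p (\<lambda>(i, j). (L ! i) j)"
  have A: "?A \<in> carrier_mat ?p ?p" by simp
  let ?B = "adj_mat ?A"
  have B: "?B \<in> carrier_mat ?p ?p" by (rule adj_mat(1)[OF A])
  define c where "c t = (\<Sum>s<?p. v s * ?B $$ (s, t))" for t
  have "vdet L * v j = (\<Sum>t<?p. c t * (L ! t) j)" if j: "j < ?p" for j
  proof -
    have e: "(\<Sum>t<?p. ?B $$ (s, t) * (L ! t) j) = (if s = j then vdet L else 0)" if s: "s < ?p" for s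
    proof -
      have "(?B * ?A) $$ (s, j) = (\<Sum>t<?p. ?B $$ (s, t) * (L ! t) j)"
        using s j B by (simp add: scalar_prod_def lessThan_atLeast0)
      then show ?thesis unfolding adj_mat(3)[OF A] using s j by (cases "s = j") (simp_all add: vdet_def)
    qed
    have "(\<Sum>t<?p. c t * (L ! t) j) = (\<Sum>s<?p. v s * (\<Sum>t<?p. ?B $$ (s, t) * (L ! t) j))"
      unfolding c_def sum_distrib_left sum_distrib_right by (subst sum.swap) (simp add: mult.assoc)
    also have "\<dots> = (\<Sum>s<?p. if s = j then v s * vdet L else 0)"
      by (rule sum.cong) (auto simp: e)
    also have "\<dots> = vdet L * v j" using j by simp
    finally show ?thesis by simp
  qed
  then show ?thesis by blast
qed

text \<open>The first \<open>k\<close> vectors of \<open>J\<close> are expanded in those of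
  \<open>L\<close>, once inside \<open>vdet J\<close> and once inside
  \<open>vdet (exch r L J)\<close>, with the same coefficients. The second expansion has a single
  surviving term, which identifies each coefficient up to powers of \<open>vdet L\<close>; these
  cancel by regularity.\<close>

lemma vdet_pluecker_regular:
  fixes L J :: "(nat \<Rightarrow> 'a::comm_ring_1) list"
  assumes q: "length J \<le> length L" and k: "k \<le> length J"
    and reg: "\<And>x. vdet L * x = 0 \<Longrightarrow> x = 0"
  shows "vdet L * vdet J = (\<Sum>r\<in>exch_idx (length L) k. vdet (exch r L J) * vdet (map ((!) L) r @ drop k J))"
proof -
  define d where "d = vdet L"
  let ?p = "length L"
  have "\<exists>c. \<forall>j<?p. d * (J ! i) j = (\<Sum>t<?p. c t * (L ! t) j)" for i
    unfolding d_def by (rule cramer_vdet)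
  then obtain c where c: "\<And>i j. j < ?p \<Longrightarrow> d * (J ! i) j = (\<Sum>t<?p. c i t * (L ! t) j)"
    by metis
  let ?W = "take k J"
  have W: "length ?W = k" using k by simp
  let ?g = "exch_coeff k c"
  have 1: "d ^ k * vdet J = (\<Sum>r\<in>exch_idx ?p k. ?g r * vdet (map ((!) L) r @ drop k J))"
  proof -
    have "d ^ k * vdet (?W @ drop k J) = (\<Sum>r\<in>exch_idx ?p k. ?g r * vdet (map ((!) L) r @ drop k J))"
    proof (rule alternating_expand[where F = "\<lambda>V. vdet (V @ drop k J)" and L = L, OF _ W])
      fix V :: "(nat \<Rightarrow> 'a) list" and i
      assume V: "length V = k" and i: "i < k"
      have *: "V[i := w] @ drop k J = (V @ drop k J)[i := w]" for w
        using V i by (simp add: list_update_append)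
      show "d * vdet (V[i := take k J ! i] @ drop k J) = (\<Sum>t<?p. c i t * vdet (V[i := L ! t] @ drop k J))"
        unfolding * by (rule vdet_linear) (use V i k q c in auto)
    next
      fix V :: "(nat \<Rightarrow> 'a) list" and i j
      assume V: "length V = k" and ij: "i < k" "j < k" "i \<noteq> j"
      have *: "V[i := V ! j, j := V ! i] @ drop k J =
          (V @ drop k J)[i := (V @ drop k J) ! j, j := (V @ drop k J) ! i]"
        using V ij by (simp add: list_update_append nth_append)
      show "vdet (V[i := V ! j, j := V ! i] @ drop k J) = - vdet (V @ drop k J)"
        unfolding * by (rule vdet_swap) (use V ij in auto)
      assume "V ! i = V ! j"
      then show "vdet (V @ drop k J) = 0"
        by (intro vdet_repeat[of i _ j]) (use V ij in \<open>auto simp: nth_append\<close>)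
    qed
    then show ?thesis by simp
  qed
  have 2: "d ^ k * vdet (exch r L J) = ?g r * d" if r: "r \<in> exch_idx ?p k" for r
  proof -
    have r': "distinct r" "length r = k" "set r \<subseteq> {..<?p}" "\<And>i. i < k \<Longrightarrow> r ! i < ?p"
      using distinct_exch_idx[OF r] r by (auto simp: exch_idx_def subset_eq)
    have "d ^ k * vdet (exch r L ?W) = (\<Sum>r'\<in>exch_idx ?p k. ?g r' * vdet (exch r L (map ((!) L) r')))"
    proof (rule alternating_expand[OF _ W])
      fix V :: "(nat \<Rightarrow> 'a) list" and i
      assume V: "length V = k" and i: "i < k"
      have *: "exch r L (V[i := w]) = (exch r L V)[r ! i := w]" for w
        using V i r' by (intro exch_update) auto
      show "d * vdet (exch r L (V[i := take k J ! i])) = (\<Sum>t<?p. c i t * vdet (exch r L (V[i := L ! t])))"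
        unfolding * by (rule vdet_linear) (use V i k q c r' in auto)
    next
      fix V :: "(nat \<Rightarrow> 'a) list" and i j
      assume V: "length V = k" and ij: "i < k" "j < k" "i \<noteq> j"
      have ne: "r ! i \<noteq> r ! j" using r' ij by (simp add: nth_eq_iff_index_eq)
      have n: "exch r L V ! (r ! a) = V ! a" if "a < k" for a
        using that r' by (intro nth_exch_in) auto
      have *: "exch r L (V[i := V ! j, j := V ! i]) =
          (exch r L V)[r ! i := exch r L V ! (r ! j), r ! j := exch r L V ! (r ! i)]"
        using V ij r' by (simp add: exch_update n)
      show "vdet (exch r L (V[i := V ! j, j := V ! i])) = - vdet (exch r L V)"
        unfolding * by (rule vdet_swap) (use V ij r' ne in auto)
      assume "V ! i = V ! j"
      then show "vdet (exch r L V) = 0"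
        by (intro vdet_repeat[of "r ! i" _ "r ! j"]) (use ij r' n ne in auto)
    qed
    also have "\<dots> = (\<Sum>r'\<in>exch_idx ?p k. if r' = r then ?g r * d else 0)"
    proof (rule sum.cong[OF refl])
      fix r' assume s: "r' \<in> exch_idx ?p k"
      have s': "distinct r'" "length r' = k" "set r' \<subseteq> {..<?p}"
        using distinct_exch_idx[OF s] s by (auto simp: exch_idx_def)
      show "?g r' * vdet (exch r L (map ((!) L) r')) = (if r' = r then ?g r * d else 0)"
      proof (cases "r' = r")
        case True
        have "exch r L (map ((!) L) r) = L"
        proof (rule nth_equalityI)
          fix b assume "b < length (exch r L (map ((!) L) r))"
          then show "exch r L (map ((!) L) r) ! b = L ! b"
            using r' by (cases "b \<in> set r") (auto simp: nth_exch_notin in_set_conv_nth nth_exch_in)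
        qed simp
        then show ?thesis using True by (simp add: d_def)
      next
        case False
        have "set r' \<noteq> set r"
          using False r s by (auto simp: exch_idx_def strict_sorted_equal)
        then have "\<not> set r' \<subseteq> set r"
          using r' s' card_subset_eq[of "set r" "set r'"] by (auto simp: distinct_card)
        then obtain x where "x \<in> set r'" "x \<notin> set r" by blast
        then obtain i where i: "i < k" "r' ! i \<notin> set r" "r' ! i < ?p"
          using s' by (metis in_set_conv_nth lessThan_iff subsetD)
        \<comment> \<open>The vector \<open>L ! (r' ! i)\<close> occurs twice: at its own position,
          which \<open>r\<close> does not touch, and at position \<open>r ! i\<close>, where it was
          inserted.\<close>
        have "vdet (exch r L (map ((!) L) r')) = 0"
        proof (rule vdet_repeat[of "r ! i" _ "r' ! i"])
          show "exch r L (map ((!) L) r') ! (r ! i) = exch r L (map ((!) L) r') ! (r' ! i)"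
            using i r' s' by (simp add: nth_exch_in nth_exch_notin)
          show "r ! i \<noteq> r' ! i" using i r' by (metis nth_mem)
        qed (use i r' in auto)
        then show ?thesis using False by simp
      qed
    qed
    also have "\<dots> = ?g r * d" using r by (simp add: finite_exch_idx)
    finally have "d ^ k * vdet (exch r L ?W) = ?g r * d" .
    moreover have "exch r L ?W = exch r L J"
      using r' k unfolding exch_def by (intro List.fold_cong) auto
    ultimately show ?thesis by simp
  qed
  let ?S = "\<Sum>r\<in>exch_idx ?p k. vdet (exch r L J) * vdet (map ((!) L) r @ drop k J)"
  have "d ^ k * (d * vdet J) = d * (d ^ k * vdet J)" by (simp add: ac_simps)
  also have "\<dots> = (\<Sum>r\<in>exch_idx ?p k. ?g r * d * vdet (map ((!) L) r @ drop k J))"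
    unfolding 1 sum_distrib_left by (simp add: ac_simps)
  also have "\<dots> = d ^ k * ?S"
    unfolding sum_distrib_left
    by (rule sum.cong[OF refl], subst 2[symmetric]) (simp_all add: mult.assoc)
  finally have "d ^ k * (d * vdet J - ?S) = 0" by (simp add: algebra_simps)
  moreover have "x = 0" if "d ^ l * x = 0" for l x
    using that by (induction l arbitrary: x) (auto simp: d_def mult.assoc dest: reg)
  ultimately have "d * vdet J - ?S = 0" by blast
  then show ?thesis by (simp add: d_def)
qed

text \<open>The case of a zero divisor \<open>vdet L\<close> is reduced to the regular one by passing from \<open>L\<close> to
  \<open>L + x I\<close> over the polynomial ring: its determinant is monic.\<close>

theorem vdet_pluecker:
  fixes L J :: "(nat \<Rightarrow> 'a::comm_ring_1) list"
  assumes q: "length J \<le> length L" and k: "k \<le> length J"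
  shows "vdet L * vdet J = (\<Sum>r\<in>exch_idx (length L) k. vdet (exch r L J) * vdet (map ((!) L) r @ drop k J))"
proof -
  let ?p = "length L"
  define L' where "L' = map (\<lambda>i j. [:(L ! i) j:] + (if i = j then [:0, 1:] else 0)) [0..<?p]"
  define J' where "J' = map (\<lambda>v j. [:v j:]) J"
  \<comment> \<open>The sign compensates for \<open>char_poly\<close> being the determinant of
    \<open>x I - A\<close>.\<close>
  let ?A = "- mat ?p ?p (\<lambda>(i, j). (L ! i) j)"
  have "vdet L' = char_poly ?A"
    unfolding vdet_def char_poly_def char_poly_matrix_def
    by (rule arg_cong[of _ _ det], rule eq_matI) (auto simp: L'_def)
  then have monic: "coeff (vdet L') (degree (vdet L')) = 1"
    using degree_monic_char_poly[of ?A ?p] by auto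
  \<comment> \<open>A monic polynomial is regular over any commutative ring, because its product
    with \<open>x\<close> has the leading coefficient of \<open>x\<close>.\<close>
  have "x = 0" if "vdet L' * x = 0" for x
    using coeff_mult_degree_sum[of "vdet L'" x] that monic by simp
  then have eq: "vdet L' * vdet J' = (\<Sum>r\<in>exch_idx ?p k. vdet (exch r L' J') * vdet (map ((!) L') r @ drop k J'))"
    using vdet_pluecker_regular[of J' L' k] q k by (simp add: L'_def J'_def)
  let ?h = "\<lambda>p :: 'a poly. poly p 0"
  have hL: "map ((\<circ>) ?h) L' = L"
    by (rule nth_equalityI) (auto simp: L'_def fun_eq_iff)
  have hJ: "map ((\<circ>) ?h) J' = J"
    by (rule nth_equalityI) (auto simp: J'_def fun_eq_iff)
  have len: "length J' = length J" by (simp add: J'_def)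
  have "?h (vdet L') * ?h (vdet J') = (\<Sum>r\<in>exch_idx ?p k. ?h (vdet (exch r L' J')) * ?h (vdet (map ((!) L') r @ drop k J')))"
    using arg_cong[OF eq, of ?h] by (simp add: poly_sum)
  also have "\<dots> = (\<Sum>r\<in>exch_idx ?p k. vdet (exch r L J) * vdet (map ((!) L) r @ drop k J))"
  proof (rule sum.cong[OF refl])
    fix r assume r: "r \<in> exch_idx ?p k"
    have "map ((\<circ>) ?h) (exch r L' J') = exch r L J"
      using r k len by (subst map_exch) (auto simp: hL hJ exch_idx_def)
    moreover have "map ((\<circ>) ?h) (map ((!) L') r @ drop k J') = map ((!) L) r @ drop k J"
    proof -
      have "?h \<circ> L' ! t = L ! t" if "t \<in> set r" for t
        using that r arg_cong[OF hL, of "\<lambda>l. l ! t"] by (auto simp: exch_idx_def L'_def)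
      then show ?thesis using arg_cong[OF hJ, of "drop k"] by (simp add: drop_map)
    qed
    ultimately show "?h (vdet (exch r L' J')) * ?h (vdet (map ((!) L') r @ drop k J')) =
        vdet (exch r L J) * vdet (map ((!) L) r @ drop k J)"
      by (simp only: poly_hom.hom_vdet)
  qed
  finally show ?thesis by (simp add: poly_hom.hom_vdet hL hJ)
qed

section \<open>Lowest monomials of minors\<close>

definition pl_eval :: "(nat list \<Rightarrow> ('m::comm_monoid_add \<Rightarrow>\<^sub>0 complex)) \<Rightarrow> pl_poly \<Rightarrow> ('m \<Rightarrow>\<^sub>0 complex)" where
  "pl_eval h f = (\<Sum>m\<in>Poly_Mapping.keys f. Poly_Mapping.single 0 (Poly_Mapping.lookup f m) *
     (\<Prod>J\<in>Poly_Mapping.keys m. h J ^ Poly_Mapping.lookup m J))"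

lemma prod_keys_superset:
  assumes "finite S" "Poly_Mapping.keys m \<subseteq> S"
  shows "(\<Prod>J\<in>Poly_Mapping.keys m. (h J :: 'a::comm_monoid_mult) ^ Poly_Mapping.lookup m J) = (\<Prod>J\<in>S. h J ^ Poly_Mapping.lookup m J)"
  by (rule prod.mono_neutral_left) (use assms in \<open>auto simp: in_keys_iff\<close>)

lemma prod_keys_add:
  "(\<Prod>J\<in>Poly_Mapping.keys (a + b). (h J :: 'a::comm_monoid_mult) ^ Poly_Mapping.lookup (a + b) J) =
   (\<Prod>J\<in>Poly_Mapping.keys a. h J ^ Poly_Mapping.lookup a J) * (\<Prod>J\<in>Poly_Mapping.keys b. h J ^ Poly_Mapping.lookup b J)"
proof -
  let ?S = "Poly_Mapping.keys a \<union> Poly_Mapping.keys b"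
  have "Poly_Mapping.keys (a + b) \<subseteq> ?S" by (rule Poly_Mapping.keys_add)
  then show ?thesis
    using prod_keys_superset[of ?S "a + b" h] prod_keys_superset[of ?S a h] prod_keys_superset[of ?S b h]
    by (simp add: lookup_add power_add prod.distrib)
qed

lemma pl_eval_superset:
  assumes "finite S" "Poly_Mapping.keys f \<subseteq> S"
  shows "pl_eval h f = (\<Sum>m\<in>S. Poly_Mapping.single 0 (Poly_Mapping.lookup f m) *
     (\<Prod>J\<in>Poly_Mapping.keys m. h J ^ Poly_Mapping.lookup m J))"
  unfolding pl_eval_def by (rule sum.mono_neutral_left) (use assms in \<open>auto simp: in_keys_iff\<close>)

lemma pl_eval_add: "pl_eval h (f + g) = pl_eval h f + pl_eval h g"
proof -
  let ?S = "Poly_Mapping.keys f \<union> Poly_Mapping.keys g"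
  have "Poly_Mapping.keys (f + g) \<subseteq> ?S" by (rule Poly_Mapping.keys_add)
  then show ?thesis
    using pl_eval_superset[of ?S "f + g" h] pl_eval_superset[of ?S f h] pl_eval_superset[of ?S g h]
    by (simp add: lookup_add single_add distrib_right sum.distrib)
qed

lemma pl_eval_single:
  "pl_eval h (Poly_Mapping.single m c) = Poly_Mapping.single 0 c * (\<Prod>J\<in>Poly_Mapping.keys m. h J ^ Poly_Mapping.lookup m J)"
  by (subst pl_eval_superset[of "{m}"]) auto

lemma pl_eval_0 [simp]: "pl_eval h 0 = 0"
  by (simp add: pl_eval_def)

lemma pl_eval_sum: "pl_eval h (sum f S) = (\<Sum>x\<in>S. pl_eval h (f x))"
  by (induction S rule: infinite_finite_induct) (auto simp: pl_eval_add)

lemma poly_mapping_sum_single: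
  "f = (\<Sum>m\<in>Poly_Mapping.keys f. Poly_Mapping.single m (Poly_Mapping.lookup f m))"
proof (rule poly_mapping_eqI)
  fix k
  show "Poly_Mapping.lookup f k = Poly_Mapping.lookup (\<Sum>m\<in>Poly_Mapping.keys f. Poly_Mapping.single m (Poly_Mapping.lookup f m)) k"
    by (simp add: lookup_sum lookup_single when_def in_keys_iff)
qed

lemma pl_eval_mult: "pl_eval h (f * g) = pl_eval h f * pl_eval h g"
proof -
  have single: "pl_eval h (Poly_Mapping.single m c * Poly_Mapping.single m' c') =
      pl_eval h (Poly_Mapping.single m c) * pl_eval h (Poly_Mapping.single m' c')" for m c m' c'
  proof -
    have c: "Poly_Mapping.single 0 (c * c') = Poly_Mapping.single 0 c * Poly_Mapping.single 0 c'"
      by (simp add: mult_single)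
    show ?thesis
      unfolding mult_single[of m] pl_eval_single prod_keys_add c by (simp only: mult_ac)
  qed
  show ?thesis
    by (subst poly_mapping_sum_single[of f], subst poly_mapping_sum_single[of g],
        subst (2) poly_mapping_sum_single[of f], subst (2) poly_mapping_sum_single[of g])
       (simp only: sum_product pl_eval_sum single)
qed

lemma pl_eval_const [simp]: "pl_eval h (pl_const c) = Poly_Mapping.single 0 c"
  by (simp add: pl_const_def pl_eval_single)

interpretation pl_eval: comm_ring_hom "pl_eval h"
  by unfold_locales
     (use pl_eval_const[of h 1] in \<open>auto simp: pl_eval_add pl_eval_mult pl_const_def\<close>)

type_synonym z_poly = "((nat \<times> nat) \<Rightarrow>\<^sub>0 nat) \<Rightarrow>\<^sub>0 complex"

text \<open>The generic upper triangular matrix, given by its columns; the row \<open>i\<close> of the tableaux is the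
  entry with index \<open>i - 1\<close>.\<close>

definition z_col :: "nat \<Rightarrow> nat \<Rightarrow> z_poly" where
  "z_col x j = (if Suc j \<le> x then Poly_Mapping.single (Poly_Mapping.single (Suc j, x) 1) 1 else 0)"

text \<open>\<open>vdet\<close> takes the columns of the generic matrix as its rows, so this is the
  transpose of the usual minor, with the same value.\<close>

definition minor :: "nat list \<Rightarrow> z_poly" where
  "minor J = vdet (map z_col J)"

lemma minor_alternating: "minor J = (if distinct J then (-1) ^ card (inversions J) * minor (sort J) else 0)"
proof (cases "distinct J")
  case True
  have "minor J = (-1) ^ card (inversions J) * minor (sort J)"
  proof (rule alternating_sort[OF _ refl])
    fix xs ys :: "nat list" and a b
    let ?V = "map z_col (xs @ b # a # ys)" and ?i = "length xs"
    have "?V[?i := ?V ! Suc ?i, Suc ?i := ?V ! ?i] = map z_col (xs @ a # b # ys)"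
      by (simp add: list_update_append nth_append)
    then show "minor (xs @ a # b # ys) = - minor (xs @ b # a # ys)"
      unfolding minor_def using vdet_swap[of ?i ?V "Suc ?i"] by simp
  qed
  then show ?thesis using True by simp
next
  case False
  then obtain i j where "i < length J" "j < length J" "i \<noteq> j" "J ! i = J ! j"
    by (auto simp: distinct_conv_nth)
  then show ?thesis using False vdet_repeat[of i "map z_col J" j] by (simp add: minor_def)
qed

lemma pl_eval_PX: "pl_eval minor (PX J) = minor J"
proof -
  have "pl_eval minor (Poly_Mapping.single (Poly_Mapping.single (sort J) 1) 1) = minor (sort J)"
    by (simp add: pl_eval_single)
  then show ?thesis
    by (subst minor_alternating) (simp add: PX_def pl_eval.hom_mult pl_eval.hom_power pl_eval.hom_uminus)
qed

lemma pl_eval_pl_rel: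
  assumes "length J \<le> length L" "k \<le> length J"
  shows "pl_eval minor (pl_rel k L J) = 0"
proof -
  have "minor (exch_L r L J) = vdet (exch r (map z_col L) (map z_col J))"
    and "minor (exch_J r L J) = vdet (map ((!) (map z_col L)) r @ drop k (map z_col J))"
    if r: "r \<in> exch_idx (length L) k" for r
  proof -
    have r': "set r \<subseteq> {..<length L}" "length r = k" using r by (auto simp: exch_idx_def)
    then have "map (z_col \<circ> (!) L) r = map ((!) (map z_col L)) r" by auto
    then have "map z_col (exch_J r L J) = map ((!) (map z_col L)) r @ drop k (map z_col J)"
      using r' by (simp add: exch_J_def drop_map del: map_eq_conv)
    then show "minor (exch_L r L J) = vdet (exch r (map z_col L) (map z_col J))"
      "minor (exch_J r L J) = vdet (map ((!) (map z_col L)) r @ drop k (map z_col J))"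
      using assms r' by (simp_all add: minor_def exch_L_eq map_exch)
  qed
  then show ?thesis
    using vdet_pluecker[of "map z_col J" "map z_col L" k] assms
    by (simp add: pl_rel_def pl_eval.hom_minus pl_eval.hom_mult pl_eval_sum pl_eval_PX minor_def)
qed

text \<open>The elements of the carrier killed by the evaluation form an ideal containing all
  generators.\<close>

lemma pl_eval_ideal:
  assumes "f \<in> pl_ideal n D"
  shows "pl_eval minor f = 0"
proof -
  let ?R = "pl_ring n D"
  interpret R: cring ?R by (rule pl_ring_cring)
  let ?K = "{f \<in> carrier ?R. pl_eval minor f = 0}"
  have inv: "\<ominus>\<^bsub>?R\<^esub> x = - x" if "x \<in> carrier ?R" for x
    by (rule R.minus_equality) (use that pl_uminus_closed[OF that] in \<open>auto simp: pl_ring_simps\<close>)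
  have "ideal ?K ?R"
  proof (rule idealI[OF R.ring_axioms])
    show "subgroup ?K (add_monoid ?R)"
    proof (rule R.add.subgroupI)
      show "?K \<noteq> {}" using pl_zero_closed[of n D] by (auto intro!: exI[of _ 0])
    qed (auto simp: inv[unfolded a_inv_def] pl_uminus_closed pl_ring_simps pl_eval_add pl_eval.hom_uminus pl_add_closed a_inv_def[symmetric] inv)
  qed (auto simp: pl_ring_simps pl_eval_mult pl_mult_closed)
  moreover have "pl_rels n D \<subseteq> ?K"
  proof
    fix f assume f: "f \<in> pl_rels n D"
    then have "pl_eval minor f = 0" unfolding pl_rels_def by (auto simp: pl_eval_pl_rel)
    then show "f \<in> ?K" using f pl_rels_carrier by auto
  qed
  ultimately have "pl_ideal n D \<subseteq> ?K"
    unfolding pl_ideal_def by (rule R.genideal_minimal)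
  with assms show ?thesis by auto
qed

section \<open>Weights and lowest terms\<close>

definition weight :: "((nat \<times> nat) \<Rightarrow>\<^sub>0 nat) \<Rightarrow> nat" where
  "weight m = (\<Sum>p\<in>Poly_Mapping.keys m. Poly_Mapping.lookup m p * (fst p * snd p))"

lemma weight_add: "weight (a + b) = weight a + weight b"
proof -
  let ?S = "Poly_Mapping.keys a \<union> Poly_Mapping.keys b"
  have "weight m = (\<Sum>p\<in>?S. Poly_Mapping.lookup m p * (fst p * snd p))" if "Poly_Mapping.keys m \<subseteq> ?S" for m
    unfolding weight_def by (rule sum.mono_neutral_left) (use that in \<open>auto simp: in_keys_iff\<close>)
  then show ?thesis
    using Poly_Mapping.keys_add[of a b] by (simp add: lookup_add distrib_right sum.distrib)
qed

lemma weight_0 [simp]: "weight 0 = 0"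
  by (simp add: weight_def)

lemma weight_single [simp]: "weight (Poly_Mapping.single p c) = c * (fst p * snd p)"
  by (cases "c = 0") (auto simp: weight_def)

lemma weight_sum: "weight (sum f S) = (\<Sum>x\<in>S. weight (f x))"
  by (induction S rule: infinite_finite_induct) (auto simp: weight_add)

text \<open>Different monomials may share a weight, so a lightest one need not be unique. Strictness
  and the coefficient 1 are demanded to let lowest terms multiply without cancellation.\<close>

definition lowest :: "z_poly \<Rightarrow> ((nat \<times> nat) \<Rightarrow>\<^sub>0 nat) \<Rightarrow> bool" where
  "lowest f m \<longleftrightarrow> (\<exists>g. f = Poly_Mapping.single m 1 + g \<and> (\<forall>k\<in>Poly_Mapping.keys g. weight m < weight k))"

lemma lowest_one: "lowest 1 0"
  unfolding lowest_def by (rule exI[of _ 0]) simp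

lemma lowest_mult:
  assumes "lowest f a" "lowest g b"
  shows "lowest (f * g) (a + b)"
proof -
  obtain f' where f: "f = Poly_Mapping.single a 1 + f'" "\<And>k. k \<in> Poly_Mapping.keys f' \<Longrightarrow> weight a < weight k"
    using assms(1) by (auto simp: lowest_def)
  obtain g' where g: "g = Poly_Mapping.single b 1 + g'" "\<And>k. k \<in> Poly_Mapping.keys g' \<Longrightarrow> weight b < weight k"
    using assms(2) by (auto simp: lowest_def)
  have le: "weight b \<le> weight k" if "k \<in> Poly_Mapping.keys g" for k
    using that g Poly_Mapping.keys_add[of "Poly_Mapping.single b 1" g'] by (force split: if_splits)
  let ?h = "Poly_Mapping.single a 1 * g' + f' * g"
  have "f * g = Poly_Mapping.single (a + b) 1 + ?h"
  proof -
    have "f * g = Poly_Mapping.single a 1 * g + f' * g" unfolding f(1) by (rule distrib_right)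
    also have "Poly_Mapping.single a 1 * g = Poly_Mapping.single (a + b) 1 + Poly_Mapping.single a 1 * g'"
      unfolding g(1) by (simp add: distrib_left mult_single)
    finally show ?thesis by (simp add: add.assoc)
  qed
  moreover have "weight (a + b) < weight k" if "k \<in> Poly_Mapping.keys ?h" for k
  proof -
    have "k \<in> Poly_Mapping.keys (Poly_Mapping.single a 1 * g') \<or> k \<in> Poly_Mapping.keys (f' * g)"
      using that Poly_Mapping.keys_add[of "Poly_Mapping.single a 1 * g'" "f' * g"] by blast
    then show ?thesis
    proof
      assume "k \<in> Poly_Mapping.keys (Poly_Mapping.single a 1 * g')"
      then obtain y where "y \<in> Poly_Mapping.keys g'" "k = a + y"
        using keys_mult[of "Poly_Mapping.single a 1" g'] by (auto split: if_splits)
      then show ?thesis using g(2)[of y] by (simp add: weight_add)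
    next
      assume "k \<in> Poly_Mapping.keys (f' * g)"
      then obtain x y where "x \<in> Poly_Mapping.keys f'" "y \<in> Poly_Mapping.keys g" "k = x + y"
        using keys_mult[of f' g] by blast
      then show ?thesis using f(2)[of x] le[of y] by (simp add: weight_add)
    qed
  qed
  ultimately show ?thesis unfolding lowest_def by blast
qed

lemma lowest_prod:
  assumes "finite S" "\<And>x. x \<in> S \<Longrightarrow> lowest (f x) (m x)"
  shows "lowest (prod f S) (sum m S)"
  using assms by (induction S) (auto simp: lowest_one intro: lowest_mult)

lemma lookup_const_mult:
  "Poly_Mapping.lookup (Poly_Mapping.single 0 c * f) k = c * Poly_Mapping.lookup f k"
  for c :: complex
  unfolding mult_map_scale_conv_mult[symmetric] by (simp add: Poly_Mapping.map.rep_eq when_def)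

text \<open>Of two different candidates each appears among the remaining terms of the other, so each
  would be strictly lighter than the other.\<close>

lemma lowest_unique:
  assumes "lowest f m" "lowest f m'"
  shows "m = m'"
proof (rule ccontr)
  assume ne: "m \<noteq> m'"
  have *: "weight a < weight b" if "lowest f a" "lowest f b" "a \<noteq> b" for a b
  proof -
    obtain g where g: "f = Poly_Mapping.single a 1 + g" "\<forall>k\<in>Poly_Mapping.keys g. weight a < weight k"
      using \<open>lowest f a\<close> by (auto simp: lowest_def)
    obtain h where h: "f = Poly_Mapping.single b 1 + h" "\<forall>k\<in>Poly_Mapping.keys h. weight b < weight k"
      using \<open>lowest f b\<close> by (auto simp: lowest_def)
    have "Poly_Mapping.lookup h b = 0" using h(2) by (auto simp: in_keys_iff)
    then have "Poly_Mapping.lookup g b = 1"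
      using arg_cong[OF g(1), of "\<lambda>f. Poly_Mapping.lookup f b"] h(1) \<open>a \<noteq> b\<close>
      by (simp add: lookup_add lookup_single when_def)
    then show ?thesis using g(2) by (auto simp: in_keys_iff)
  qed
  from *[OF assms ne] *[OF assms(2,1)] ne show False by auto
qed

text \<open>Among the members with nonzero coefficient one takes \<open>h\<close> with the lightest
  lowest monomial. The coefficient of \<open>m h\<close> in the sum is then \<open>c h\<close>: the
  other lowest monomials differ from it by injectivity, and all further terms are heavier.\<close>

lemma lowest_independent:
  assumes fin: "finite G" and low: "\<And>g. g \<in> G \<Longrightarrow> lowest (F g) (m g)" and inj: "inj_on m G"
    and zero: "(\<Sum>g\<in>G. Poly_Mapping.single 0 (c g) * F g) = 0" and g: "g \<in> G"
  shows "c g = 0"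
proof (rule ccontr)
  assume "c g \<noteq> 0"
  define N where "N = {g \<in> G. c g \<noteq> 0}"
  have "finite N" "N \<noteq> {}" using fin g \<open>c g \<noteq> 0\<close> by (auto simp: N_def)
  then obtain h where h: "h \<in> N" "\<And>g. g \<in> N \<Longrightarrow> weight (m h) \<le> weight (m g)"
    using ex_is_arg_min_if_finite[of N "\<lambda>g. weight (m g)"] unfolding is_arg_min_linorder by blast
  have "c g * Poly_Mapping.lookup (F g) (m h) = (if g = h then c h else 0)" if g: "g \<in> G" for g
  proof (cases "c g = 0")
    case False
    then have le: "weight (m h) \<le> weight (m g)" using h g by (auto simp: N_def)
    obtain k where k: "F g = Poly_Mapping.single (m g) 1 + k" "\<forall>x\<in>Poly_Mapping.keys k. weight (m g) < weight x"
      using low[OF g] by (auto simp: lowest_def)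
    have "Poly_Mapping.lookup k (m h) = 0" using bspec[OF k(2), of "m h"] le by (fastforce simp: in_keys_iff)
    moreover have "m g = m h \<longleftrightarrow> g = h" using inj g h by (auto simp: N_def inj_on_def)
    ultimately show ?thesis by (auto simp: k(1) lookup_add lookup_single when_def)
  qed (use h in \<open>auto simp: N_def\<close>)
  then have "Poly_Mapping.lookup (\<Sum>g\<in>G. Poly_Mapping.single 0 (c g) * F g) (m h) = c h"
    using h fin by (simp add: lookup_sum lookup_const_mult N_def)
  then show False using zero h by (simp add: N_def)
qed

section \<open>The lowest term of the minor of a PBW column\<close>

definition pbw_col :: "nat list \<Rightarrow> bool" where
  "pbw_col T \<longleftrightarrow> (\<forall>i<length T. T ! i = Suc i \<or> length T < T ! i) \<and>
     (\<forall>i j. i < j \<longrightarrow> j < length T \<longrightarrow> T ! i \<noteq> Suc i \<longrightarrow> T ! j < T ! i)"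

text \<open>An entry equal to its row number differs from the later entries, which are larger row
  numbers or exceed the length; any other entry is greater than all later ones.\<close>

lemma pbw_col_distinct: "pbw_col T \<Longrightarrow> distinct T"
  unfolding distinct_conv_nth
proof (intro allI impI)
  have *: "T ! i \<noteq> T ! j" if "pbw_col T" "i < j" "j < length T" for i j
    using that unfolding pbw_col_def by (cases "T ! i = Suc i") fastforce+
  fix i j assume "pbw_col T" "i < length T" "j < length T" "i \<noteq> j"
  then show "T ! i \<noteq> T ! j" using *[of i j] *[of j i] by (cases "i < j") auto
qed

text \<open>The rows of the minor are assigned to the entries of the column by \<open>p\<close>. Any assignment other
  than the identity admits a transposition that lowers the weight and stays above the diagonal.\<close>

lemma pbw_col_improve:
  assumes T: "pbw_col T" and p: "p permutes {..<length T}" and feas: "\<And>i. i < length T \<Longrightarrow> Suc (p i) \<le> T ! i"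
    and "p \<noteq> id"
  shows "\<exists>x<length T. \<exists>y<length T. p y < p x \<and> T ! y < T ! x \<and> Suc (p x) \<le> T ! y"
proof -
  \<comment> \<open>All positions before \<open>i\<close> keep their row. Hence row \<open>i\<close>
    is taken by a later position \<open>b\<close>, and position \<open>i\<close> moves down, so its
    entry cannot be \<open>Suc i\<close>.\<close>
  define i where "i = (LEAST i. p i \<noteq> i)"
  obtain i0 where "p i0 \<noteq> i0" using \<open>p \<noteq> id\<close> by (auto simp: fun_eq_iff)
  then have pi: "p i \<noteq> i" and least: "\<And>j. j < i \<Longrightarrow> p j = j"
    unfolding i_def by (rule LeastI) (use not_less_Least in blast)
  have il: "i < length T" using p pi by (auto simp: permutes_def)
  have inj: "inj p" by (rule permutes_inj[OF p])
  have in_im: "\<And>x. p x < length T \<longleftrightarrow> x < length T" using permutes_in_image[OF p] by simp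
  have "i < p i"
    using least[of "p i"] pi inj by (metis injD linorder_neqE_nat)
  obtain b where b: "p b = i" using permutes_surj[OF p] by (metis surjD)
  have "i < b" using least[of b] b pi by (metis linorder_neqE_nat)
  have bl: "b < length T" using in_im[of b] b il by simp
  have Ti: "T ! i \<noteq> Suc i" using feas[OF il] \<open>i < p i\<close> by auto
  then have lt: "T ! b < T ! i" using T \<open>i < b\<close> bl by (auto simp: pbw_col_def)
  show ?thesis
  proof (cases "T ! b = Suc b")
    case False
    then have "length T < T ! b" using T bl by (auto simp: pbw_col_def)
    then have "Suc (p i) \<le> T ! b" using in_im[of i] il by simp
    then show ?thesis using il bl lt b \<open>i < p i\<close> by blast
  next
    case True
    \<comment> \<open>Position \<open>b\<close> holds its own row number and cannot take a row
      beyond \<open>b\<close>. It is exchanged with the position \<open>a\<close> that occupies row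
      \<open>b\<close> and so returns to its own row.\<close>
    obtain a where a: "p a = b" using permutes_surj[OF p] by (metis surjD)
    have al: "a < length T" using in_im[of a] a bl by simp
    have "a \<noteq> b" using a b \<open>i < b\<close> by auto
    then have "T ! a \<noteq> T ! b" using pbw_col_distinct[OF T] al bl by (simp add: nth_eq_iff_index_eq)
    then have "T ! b < T ! a" using feas[OF al] a True by simp
    then show ?thesis using al bl a b \<open>i < b\<close> True by (metis order_refl)
  qed
qed

text \<open>The monomial of the Leibniz term in which the entry at position \<open>i\<close> is
  assigned to row \<open>p i\<close>, counted from 0.\<close>

definition assign_mon :: "nat list \<Rightarrow> (nat \<Rightarrow> nat) \<Rightarrow> ((nat \<times> nat) \<Rightarrow>\<^sub>0 nat)" where
  "assign_mon T p = (\<Sum>i<length T. Poly_Mapping.single (Suc (p i), T ! i) 1)"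

lemma weight_assign_mon: "weight (assign_mon T p) = (\<Sum>i<length T. Suc (p i) * T ! i)"
  by (simp add: assign_mon_def weight_sum)

lemma weight_transpose_less:
  assumes "x < length T" "y < length T" "p y < p x" "T ! y < T ! x"
  shows "weight (assign_mon T (p \<circ> Transposition.transpose x y)) < weight (assign_mon T p)"
proof -
  let ?A = "{..<length T} - {x} - {y}"
  have xy: "x \<noteq> y" using assms by auto
  have split: "(\<Sum>i<length T. f i) = f x + (f y + sum f ?A)" for f :: "nat \<Rightarrow> nat"
    using assms xy by (subst sum.remove[of _ x], simp, simp, subst sum.remove[of _ y]) auto
  have eq: "(\<Sum>i\<in>?A. Suc ((p \<circ> Transposition.transpose x y) i) * T ! i) = (\<Sum>i\<in>?A. Suc (p i) * T ! i)"
    by (rule sum.cong) auto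
  \<comment> \<open>\<open>Suc u\<close> and \<open>Suc v\<close> are the differences of the rows
    and of the entries; the transposition lowers the weight by their product.\<close>
  obtain u v where u: "p x = p y + Suc u" and v: "T ! x = T ! y + Suc v"
    using assms less_imp_Suc_add[of "p y" "p x"] less_imp_Suc_add[of "T ! y" "T ! x"] by auto
  show ?thesis
    unfolding weight_assign_mon split eq using u v xy by (simp add: algebra_simps)
qed

text \<open>Descent: as long as \<open>p\<close> is not the identity, some transposition gives
  another admissible assignment of smaller weight, so the process can end only at the
  identity.\<close>

lemma pbw_col_weight:
  assumes T: "pbw_col T" and p: "p permutes {..<length T}" and feas: "\<And>i. i < length T \<Longrightarrow> Suc (p i) \<le> T ! i"
  shows "p = id \<or> weight (assign_mon T id) < weight (assign_mon T p)"
  using p feas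
proof (induction "weight (assign_mon T p)" arbitrary: p rule: less_induct)
  case less
  show ?case
  proof (cases "p = id")
    case False
    obtain x y where xy: "x < length T" "y < length T" "p y < p x" "T ! y < T ! x" "Suc (p x) \<le> T ! y"
      using pbw_col_improve[OF T less.prems False] by blast
    let ?q = "p \<circ> Transposition.transpose x y"
    have lt: "weight (assign_mon T ?q) < weight (assign_mon T p)"
      using xy by (intro weight_transpose_less)
    have "?q permutes {..<length T}"
      using xy less.prems by (intro permutes_compose permutes_swap_id) auto
    moreover have "Suc (?q i) \<le> T ! i" if "i < length T" for i
      using that xy less.prems(2)[of i] less.prems(2)[of x] by (auto simp: Transposition.transpose_def)
    ultimately have "?q = id \<or> weight (assign_mon T id) < weight (assign_mon T ?q)"
      using less.hyps lt by blast
    then show ?thesis using lt by auto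
  qed simp
qed

lemma prod_single_one:
  "finite S \<Longrightarrow> (\<Prod>i\<in>S. Poly_Mapping.single (m i) (1 :: complex)) = Poly_Mapping.single (sum m S) 1"
  for m :: "'b \<Rightarrow> 'a::comm_monoid_add"
  by (induction S rule: finite_induct) (auto simp: mult_single)

text \<open>A Leibniz term with a factor below the diagonal vanishes. Every other one is a signed
  monomial, and \<open>pbw_col_weight\<close> makes it heavier than the term of the
  identity.\<close>

lemma lowest_minor:
  assumes T: "pbw_col T"
  shows "lowest (minor T) (assign_mon T id)"
proof -
  let ?d = "length T"
  let ?P = "{p. p permutes {..<?d}}"
  let ?t = "\<lambda>p. signof p * (\<Prod>i<?d. z_col (T ! i) (p i))"
  have "minor T = (\<Sum>p\<in>?P. ?t p)"
    unfolding minor_def vdet_def det_def by (auto simp: permutes_in_image lessThan_atLeast0 intro!: sum.cong prod.cong)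
  also have "\<dots> = ?t id + (\<Sum>p\<in>?P - {id}. ?t p)"
    by (rule sum.remove) (auto simp: finite_permutations permutes_id)
  also have "?t id = Poly_Mapping.single (assign_mon T id) 1"
  proof -
    have "Suc i \<le> T ! i" if "i < ?d" for i
      using T that by (fastforce simp: pbw_col_def)
    then have "(\<Prod>i<?d. z_col (T ! i) (id i)) = (\<Prod>i<?d. Poly_Mapping.single (Poly_Mapping.single (Suc i, T ! i) 1) 1)"
      by (intro prod.cong) (auto simp: z_col_def)
    then show ?thesis by (simp add: prod_single_one assign_mon_def)
  qed
  finally have eq: "minor T = Poly_Mapping.single (assign_mon T id) 1 + (\<Sum>p\<in>?P - {id}. ?t p)" .
  have "weight (assign_mon T id) < weight k" if k: "k \<in> Poly_Mapping.keys (?t p)" and p: "p \<in> ?P - {id}" for k p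
  proof -
    have "k \<in> Poly_Mapping.keys (\<Prod>i<?d. z_col (T ! i) (p i))"
      using k signof_pm_one[of p] by (auto simp: sign_def split: if_splits)
    moreover have feas: "Suc (p i) \<le> T ! i" if "i < ?d" for i
    proof (rule ccontr)
      assume "\<not> Suc (p i) \<le> T ! i"
      then have "(\<Prod>i<?d. z_col (T ! i) (p i)) = 0"
        using that by (intro prod_zero) (auto simp: z_col_def)
      then show False using calculation by simp
    qed
    moreover have "(\<Prod>i<?d. z_col (T ! i) (p i)) = (\<Prod>i<?d. Poly_Mapping.single (Poly_Mapping.single (Suc (p i), T ! i) 1) 1)"
      using feas by (intro prod.cong) (auto simp: z_col_def)
    ultimately have "k = assign_mon T p" by (simp add: prod_single_one assign_mon_def)
    then show ?thesis using pbw_col_weight[OF T, of p] p feas by auto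
  qed
  moreover have "Poly_Mapping.keys (\<Sum>p\<in>?P - {id}. ?t p) \<subseteq> (\<Union>p\<in>?P - {id}. Poly_Mapping.keys (?t p))"
    by (rule keys_sum)
  ultimately show ?thesis unfolding lowest_def using eq by blast
qed

section \<open>Semistandard PBW-tableaux\<close>

lemma initial_segment:
  assumes "finite A" "\<And>j. j \<in> A \<Longrightarrow> 1 \<le> j" "\<And>j. j \<in> A \<Longrightarrow> 1 < j \<Longrightarrow> j - 1 \<in> A"
  shows "A = {1..card A}"
proof (cases "A = {}")
  case False
  have "Max A \<in> A" using assms(1) False by (rule Max_in)
  have down: "x - k \<in> A" if "x \<in> A" "k < x" for x k
    using that(2)
  proof (induction k)
    case (Suc k)
    then show ?case using assms(3)[of "x - k"] by simp
  qed (use that in simp)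
  have "A = {1..Max A}"
  proof (intro equalityI subsetI)
    fix y assume "y \<in> {1..Max A}"
    then show "y \<in> A" using down[OF \<open>Max A \<in> A\<close>, of "Max A - y"] by auto
  qed (use assms in auto)
  then show ?thesis by (metis card_atLeastAtMost diff_Suc_1)
qed simp

section \<open>Diagrams and their columns\<close>

lemma part_antimono: "i \<le> i' \<Longrightarrow> part n m i' \<le> part n m i"
  unfolding part_def by (rule sum_mono2) auto

lemma part_Suc: "i \<le> n - 1 \<Longrightarrow> part n m i = m i + part n m (Suc i)"
  unfolding part_def by (subst sum.atLeast_Suc_atMost) auto

text \<open>Row lengths weakly decrease, so the boxes of a column form an initial segment. A column
  outside the diagram has length 0, which makes the equivalence valid for every
  \<open>j\<close>.\<close>

lemma diagram_iff: "(i, j) \<in> diagram n m \<longleftrightarrow> 1 \<le> i \<and> i \<le> col_len n m j"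
proof -
  let ?A = "{i. (i, j) \<in> diagram n m}"
  have "?A \<subseteq> {..n}" by (auto simp: diagram_def)
  then have "?A = {1..card ?A}"
    by (intro initial_segment)
       (auto simp: diagram_def finite_subset intro: order_trans[OF _ part_antimono])
  then show ?thesis unfolding col_len_def by (metis atLeastAtMost_iff mem_Collect_eq)
qed

lemma diagramD: "(i, j) \<in> diagram n m \<Longrightarrow> 1 \<le> i \<and> i \<le> n - 1 \<and> 1 \<le> j \<and> j \<le> part n m i \<and> j \<le> part n m 1"
  using part_antimono[of 1 i n m] by (auto simp: diagram_def)

lemma finite_row: "finite {j. (i, j) \<in> diagram n m \<and> P j}"
  by (rule finite_subset[of _ "{..part n m 1}"]) (use diagramD in auto)

lemma diagram_left: "(i, j) \<in> diagram n m \<Longrightarrow> 1 < j \<Longrightarrow> (i, j - 1) \<in> diagram n m"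
  by (auto simp: diagram_def)

lemma col_len_antimono: "1 \<le> j \<Longrightarrow> j \<le> j' \<Longrightarrow> col_len n m j' \<le> col_len n m j"
proof -
  assume j: "1 \<le> j" "j \<le> j'"
  show ?thesis
  proof (cases "col_len n m j' = 0")
    case False
    then have "(col_len n m j', j') \<in> diagram n m" by (simp add: diagram_iff)
    then have "(col_len n m j', j) \<in> diagram n m" using j by (auto simp: diagram_def)
    then show ?thesis by (simp add: diagram_iff)
  qed simp
qed

lemma col_len_pos: "1 < n \<Longrightarrow> 1 \<le> j \<Longrightarrow> j \<le> part n m 1 \<Longrightarrow> 1 \<le> col_len n m j"
  using diagram_iff[of 1 j n m] by (auto simp: diagram_def)

lemma col_len_le: "col_len n m j \<le> n - 1"
proof (cases "col_len n m j = 0")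
  case False
  then have "(col_len n m j, j) \<in> diagram n m" by (simp add: diagram_iff)
  then show ?thesis by (auto simp: diagram_def)
qed simp

text \<open>If the coefficient of index \<open>c\<close> were 0, rows \<open>c\<close> and
  \<open>c + 1\<close> would have the same length, and no column could end in row
  \<open>c\<close>.\<close>

lemma col_len_in:
  assumes "1 < n" "m \<in> P_plus D" "1 \<le> j" "j \<le> part n m 1"
  shows "col_len n m j \<in> D"
proof (rule ccontr)
  let ?c = "col_len n m j"
  assume "?c \<notin> D"
  then have "m ?c = 0" using assms by (auto simp: P_plus_def)
  have "1 \<le> ?c" using assms by (intro col_len_pos)
  then have "(?c, j) \<in> diagram n m" by (simp add: diagram_iff)
  then have "j \<le> part n m (Suc ?c)" using part_Suc[of ?c n m] \<open>m ?c = 0\<close> col_len_le[of n m j] by (auto simp: diagram_def)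
  \<comment> \<open>Otherwise the sum defining \<open>part\<close> is empty, and \<open>j\<close>
    would be 0.\<close>
  moreover from this have "Suc ?c \<le> n - 1"
    using assms(3) by (rule_tac ccontr) (auto simp: part_def)
  ultimately have "(Suc ?c, j) \<in> diagram n m" using assms by (auto simp: diagram_def)
  then show False by (simp add: diagram_iff)
qed

lemma length_column [simp]: "length (column n m T j) = col_len n m j"
  by (simp add: column_def)

lemma nth_column [simp]: "i < col_len n m j \<Longrightarrow> column n m T j ! i = T (Suc i, j)"
  by (simp add: column_def del: upt_Suc)

lemma pbw_col_column:
  assumes "T \<in> PBW_tableaux n m"
  shows "pbw_col (column n m T j)"
proof -
  have "T (Suc i, j) = Suc i \<or> col_len n m j < T (Suc i, j)" if "i < col_len n m j" for i
    using assms that by (auto simp: PBW_tableaux_def diagram_iff not_less)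
  moreover have "T (Suc i', j) < T (Suc i, j)" if "i < i'" "i' < col_len n m j" "T (Suc i, j) \<noteq> Suc i" for i i'
  proof -
    have "(Suc i, j) \<in> diagram n m" "(Suc i', j) \<in> diagram n m" using that by (auto simp: diagram_iff)
    then show ?thesis using assms that unfolding PBW_tableaux_def by blast
  qed
  ultimately show ?thesis by (simp add: pbw_col_def)
qed

lemma PBW_range: "T \<in> PBW_tableaux n m \<Longrightarrow> (i, j) \<in> diagram n m \<Longrightarrow> i \<le> T (i, j) \<and> T (i, j) \<in> {1..n}"
proof -
  assume T: "T \<in> PBW_tableaux n m" and ij: "(i, j) \<in> diagram n m"
  then have "T (i, j) \<in> {1..n}" by (auto simp: PBW_tableaux_def)
  moreover have "T (i, j) = i \<or> col_len n m j < T (i, j)"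
    using T ij by (auto simp: PBW_tableaux_def not_less)
  ultimately show ?thesis using ij by (auto simp: diagram_iff)
qed

section \<open>Recovery of a tableau from the contents of its rows\<close>

definition tab_mon :: "nat \<Rightarrow> (nat \<Rightarrow> nat) \<Rightarrow> (nat \<times> nat \<Rightarrow> nat) \<Rightarrow> ((nat \<times> nat) \<Rightarrow>\<^sub>0 nat)" where
  "tab_mon n m T = (\<Sum>j = 1..part n m 1. assign_mon (column n m T j) id)"

lemma lowest_X_tab:
  assumes "T \<in> PBW_tableaux n m"
  shows "lowest (pl_eval minor (X_tab n m T)) (tab_mon n m T)"
proof -
  have "pl_eval minor (X_tab n m T) = (\<Prod>j = 1..part n m 1. minor (column n m T j))"
    unfolding X_tab_def by (simp add: pl_eval.hom_prod pl_eval_PX)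
  then show ?thesis unfolding tab_mon_def
    by (auto intro!: lowest_prod lowest_minor pbw_col_column assms)
qed

lemma lookup_tab_mon:
  "1 \<le> a \<Longrightarrow> Poly_Mapping.lookup (tab_mon n m T) (a, b) = card {j. (a, j) \<in> diagram n m \<and> T (a, j) = b}"
proof -
  assume a: "1 \<le> a"
  have "Poly_Mapping.lookup (assign_mon (column n m T j) id) (a, b) =
      (if (a, j) \<in> diagram n m \<and> T (a, j) = b then 1 else 0)" for j
  proof -
    have "Poly_Mapping.lookup (assign_mon (column n m T j) id) (a, b) =
        (\<Sum>i<col_len n m j. if i = a - 1 then (if T (a, j) = b then 1 else 0) else 0)"
      unfolding assign_mon_def lookup_sum length_column
      by (rule sum.cong) (use a in \<open>auto simp: lookup_single when_def\<close>)
    then show ?thesis using a by (auto simp: diagram_iff)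
  qed
  then have "Poly_Mapping.lookup (tab_mon n m T) (a, b) =
      (\<Sum>j\<in>{1..part n m 1}. if (a, j) \<in> diagram n m \<and> T (a, j) = b then 1 else 0)"
    unfolding tab_mon_def lookup_sum by simp
  also have "\<dots> = card {j \<in> {1..part n m 1}. (a, j) \<in> diagram n m \<and> T (a, j) = b}"
    by (simp add: sum.If_cases Int_def)
  also have "{j \<in> {1..part n m 1}. (a, j) \<in> diagram n m \<and> T (a, j) = b} = {j. (a, j) \<in> diagram n m \<and> T (a, j) = b}"
    using diagramD by auto
  finally show ?thesis .
qed

text \<open>The total degree in the variables of row \<open>a\<close> is the length of that row, and
  consecutive row lengths differ by \<open>m a\<close>. Outside \<open>D\<close> both weights
  vanish.\<close>

lemma tab_mon_weight_eq:
  assumes "m \<in> P_plus D" "m' \<in> P_plus D" "D \<subseteq> {1..n - 1}"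
    and T: "T \<in> PBW_tableaux n m" and T': "T' \<in> PBW_tableaux n m'"
    and eq: "tab_mon n m T = tab_mon n m' T'"
  shows "m = m'"
proof -
  have part: "part n m a = (\<Sum>b\<in>{1..n}. Poly_Mapping.lookup (tab_mon n m T) (a, b))"
    if a: "a \<in> {1..n - 1}" and T: "T \<in> PBW_tableaux n m" for a m T
  proof -
    have "{1..part n m a} = (\<Union>b\<in>{1..n}. {j. (a, j) \<in> diagram n m \<and> T (a, j) = b})"
      using a PBW_range[OF T] by (auto simp: diagram_def)
    moreover have "card (\<Union>b\<in>{1..n}. {j. (a, j) \<in> diagram n m \<and> T (a, j) = b}) =
        (\<Sum>b\<in>{1..n}. card {j. (a, j) \<in> diagram n m \<and> T (a, j) = b})"
      by (rule card_UN_disjoint) (auto simp: finite_row)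
    ultimately have "card {1..part n m a} = (\<Sum>b\<in>{1..n}. card {j. (a, j) \<in> diagram n m \<and> T (a, j) = b})"
      by (simp only:)
    then show ?thesis using a by (simp add: lookup_tab_mon)
  qed
  have eq': "part n m a = part n m' a" if "1 \<le> a" for a
  proof (cases "a \<le> n - 1")
    case True
    then show ?thesis using that part[OF _ T] part[OF _ T'] eq by simp
  qed (simp add: part_def)
  show ?thesis
  proof
    fix a
    show "m a = m' a"
    proof (cases "a \<in> {1..n - 1}")
      case True
      then show ?thesis using eq'[of a] eq'[of "Suc a"] part_Suc[of a n m] part_Suc[of a n m'] by simp
    next
      case False
      then have "a \<notin> D" using assms by blast
      then show ?thesis using assms by (simp add: P_plus_def)
    qed
  qed
qed

definition tail_ge :: "nat \<Rightarrow> (nat \<Rightarrow> nat) \<Rightarrow> (nat \<times> nat \<Rightarrow> nat) \<Rightarrow> nat \<Rightarrow> nat \<Rightarrow> nat set" where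
  "tail_ge n m T i l = {j. \<exists>i1\<ge>i. (i1, j) \<in> diagram n m \<and> l \<le> T (i1, j)}"

text \<open>Semistandardness, applied to the box that puts column \<open>j\<close> into the set,
  yields a box of column \<open>j - 1\<close> at least as low and with at least as large an
  entry.\<close>

lemma tail_ge_segment:
  assumes "T \<in> semistandard_PBW n m"
  shows "tail_ge n m T i l = {1..card (tail_ge n m T i l)}"
proof (rule initial_segment)
  show "finite (tail_ge n m T i l)"
    by (rule finite_subset[of _ "{..part n m 1}"]) (use diagramD in \<open>auto simp: tail_ge_def\<close>)
  fix j assume j: "j \<in> tail_ge n m T i l"
  then obtain i1 where i1: "i \<le> i1" "(i1, j) \<in> diagram n m" "l \<le> T (i1, j)"
    by (auto simp: tail_ge_def)
  then show "1 \<le> j" using diagramD by blast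
  assume "1 < j"
  then obtain i2 where "i1 \<le> i2" "(i2, j - 1) \<in> diagram n m" "T (i1, j) \<le> T (i2, j - 1)"
    using assms i1 unfolding semistandard_PBW_def by blast
  then show "j - 1 \<in> tail_ge n m T i l" using i1 unfolding tail_ge_def by (auto intro: order_trans)
qed

text \<open>The columns in which the part from row \<open>i\<close> on has an entry \<open>\<ge> l\<close> form an initial segment.
  Its length is known from the rows below, the entries \<open>> l\<close> of row \<open>i\<close>, and the multiplicity
  of \<open>l\<close> in row \<open>i\<close>; so the rows can be recovered from their contents, from bottom to top.\<close>

lemma tab_mon_inj:
  assumes T: "T \<in> semistandard_PBW n m" and T': "T' \<in> semistandard_PBW n m"
    and eq: "tab_mon n m T = tab_mon n m T'"
  shows "T = T'"
proof -
  have P: "T \<in> PBW_tableaux n m" and P': "T' \<in> PBW_tableaux n m"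
    using T T' by (auto simp: semistandard_PBW_def)
  let ?S = "\<lambda>T i l. {j. (i, j) \<in> diagram n m \<and> T (i, j) = l}"
  let ?G = "\<lambda>T i l. {j. (i, j) \<in> diagram n m \<and> l < T (i, j)}"
  have dec: "tail_ge n m T i l = (tail_ge n m T (Suc i) l \<union> ?G T i l) \<union> ?S T i l" for T i l
  proof (intro equalityI subsetI)
    fix j assume "j \<in> tail_ge n m T i l"
    then obtain i1 where i1: "i \<le> i1" "(i1, j) \<in> diagram n m" "l \<le> T (i1, j)"
      by (auto simp: tail_ge_def)
    show "j \<in> (tail_ge n m T (Suc i) l \<union> ?G T i l) \<union> ?S T i l"
    proof (cases "i1 = i")
      case True
      then show ?thesis using i1 by auto
    next
      case False
      then have "Suc i \<le> i1" using i1 by simp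
      then show ?thesis using i1 unfolding tail_ge_def by blast
    qed
  next
    fix j assume j: "j \<in> (tail_ge n m T (Suc i) l \<union> ?G T i l) \<union> ?S T i l"
    show "j \<in> tail_ge n m T i l"
    proof (cases "j \<in> tail_ge n m T (Suc i) l")
      case True
      then show ?thesis unfolding tail_ge_def using Suc_leD by blast
    next
      case False
      then have "(i, j) \<in> diagram n m" "l \<le> T (i, j)" using j by auto
      then show ?thesis unfolding tail_ge_def by blast
    qed
  qed
  \<comment> \<open>For \<open>l > i\<close> an entry \<open>l\<close> in row \<open>i\<close> is
    not the row number, so everything below it in its column is smaller.\<close>
  have disj: "(tail_ge n m T (Suc i) l \<union> ?G T i l) \<inter> ?S T i l = {}"
    if il: "i < l" and T: "T \<in> PBW_tableaux n m" for T i l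
  proof -
    have "j \<notin> tail_ge n m T (Suc i) l \<union> ?G T i l" if j: "(i, j) \<in> diagram n m" "T (i, j) = l" for j
    proof
      assume "j \<in> tail_ge n m T (Suc i) l \<union> ?G T i l"
      then obtain i1 where i1: "i < i1" "(i1, j) \<in> diagram n m" "l \<le> T (i1, j)"
        using j by (auto simp: tail_ge_def Suc_le_eq)
      have "T (i, j) \<noteq> i" using j il by simp
      then have "T (i1, j) < T (i, j)"
        using T j(1) i1(1,2) unfolding PBW_tableaux_def by blast
      then show False using i1 j by simp
    qed
    then show ?thesis by blast
  qed
  have fin: "finite (tail_ge n m T i l)" for T i l
    by (rule finite_subset[of _ "{..part n m 1}"]) (use diagramD in \<open>auto simp: tail_ge_def\<close>)
  have row: "T (i, j) = T' (i, j)" if "(i, j) \<in> diagram n m" for i j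
    using that
  proof (induction "n - i" arbitrary: i j rule: less_induct)
    case less
    have below: "T (i', j) = T' (i', j)" if "(i', j) \<in> diagram n m" "i < i'" for i' j
      using less.hyps[of i' j] that diagramD[OF that(1)] by auto
    then have tail: "tail_ge n m T (Suc i) l = tail_ge n m T' (Suc i) l" for l
      unfolding tail_ge_def by (auto simp: Suc_le_eq)
    have i1: "1 \<le> i" using less.prems diagramD by blast
    \<comment> \<open>Within row \<open>i\<close> the induction runs from the largest entries down,
      so the boxes with an entry \<open>> l\<close> are already known.\<close>
    have S: "?S T i l = ?S T' i l" if "i < l" for l
      using that
    proof (induction "n - l" arbitrary: l rule: less_induct)
      case (less l)
      have G: "?G T i l = ?G T' i l"
      proof -
        have st: "(i, j) \<in> diagram n m \<and> T (i, j) = l' \<longleftrightarrow> (i, j) \<in> diagram n m \<and> T' (i, j) = l'"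
          if "l < l'" "l' \<le> n" for l' j
        proof -
          have "?S T i l' = ?S T' i l'" using less that by auto
          then show ?thesis by blast
        qed
        have "T (i, j) = T' (i, j)" if "(i, j) \<in> diagram n m" "l < T (i, j) \<or> l < T' (i, j)" for j
        proof -
          have "T (i, j) \<le> n" "T' (i, j) \<le> n" using that PBW_range[OF P] PBW_range[OF P'] by auto
          then show ?thesis using st[of "T (i, j)" j] st[of "T' (i, j)" j] that by metis
        qed
        then show ?thesis by (intro Collect_cong) metis
      qed
      have TG: "tail_ge n m T (Suc i) l \<union> ?G T i l = tail_ge n m T' (Suc i) l \<union> ?G T' i l"
        by (simp only: tail[of l] G)
      have cS: "card (?S T i l) = card (?S T' i l)"
        using lookup_tab_mon[OF i1, of n m T l] lookup_tab_mon[OF i1, of n m T' l] eq by simp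
      have cU: "card (tail_ge n m U i l) = card (tail_ge n m U (Suc i) l \<union> ?G U i l) + card (?S U i l)"
        if "U \<in> PBW_tableaux n m" for U
        unfolding dec[of U i l]
      proof (rule card_Un_disjoint[OF _ _ disj[OF less.prems that]])
        have "finite ((tail_ge n m U (Suc i) l \<union> ?G U i l) \<union> ?S U i l)"
          using fin[of U i l] unfolding dec[of U i l] .
        then show "finite (tail_ge n m U (Suc i) l \<union> ?G U i l)" "finite (?S U i l)"
          unfolding finite_Un by blast+
      qed
      have "card (tail_ge n m T i l) = card (tail_ge n m T' i l)"
        by (simp only: cU[OF P] cU[OF P'] TG cS)
      then have tT: "tail_ge n m T i l = tail_ge n m T' i l"
        using tail_ge_segment[OF T] tail_ge_segment[OF T'] by metis
      have sU: "?S U i l = tail_ge n m U i l - (tail_ge n m U (Suc i) l \<union> ?G U i l)"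
        if "U \<in> PBW_tableaux n m" for U
        unfolding dec[of U i l] Un_Diff_cancel2 Un_Diff Diff_cancel Un_empty_left
        using Diff_triv[OF disj[OF less.prems that, unfolded Int_commute[of _ "?S U i l"]]] by simp
      show ?case unfolding sU[OF P] sU[OF P'] TG tT ..
    qed
    \<comment> \<open>Entries equal to \<open>i\<close> are not reached by \<open>S\<close>. They
      fill the boxes left over, since row \<open>i\<close> has no smaller entries.\<close>
    show ?case
    proof (cases "T (i, j) = i")
      case True
      have "\<not> i < T' (i, j)"
      proof
        assume lt: "i < T' (i, j)"
        have "j \<in> ?S T i (T' (i, j))" unfolding S[OF lt] using less.prems by simp
        then show False using lt True by simp
      qed
      then show ?thesis using True PBW_range[OF P' less.prems] by simp
    next
      case False
      then have lt: "i < T (i, j)" using PBW_range[OF P less.prems] by simp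
      have "j \<in> ?S T' i (T (i, j))" unfolding S[OF lt, symmetric] using less.prems by simp
      then show ?thesis by simp
    qed
  qed
  show ?thesis
  proof
    fix x
    show "T x = T' x"
    proof (cases "x \<in> diagram n m")
      case False
      have "T \<in> diagram n m \<rightarrow>\<^sub>E {1..n}" "T' \<in> diagram n m \<rightarrow>\<^sub>E {1..n}"
        using P P' by (auto simp only: PBW_tableaux_def)
      then show ?thesis using PiE_arb[OF _ False] by metis
    qed (use row in \<open>cases x; simp\<close>)
  qed
qed

section \<open>Ordinary semistandard tableaux and their translation into PBW-tableaux\<close>

definition ssyt :: "nat \<Rightarrow> nat list \<Rightarrow> nat list list set" where
  "ssyt n ls = {cs. map length cs = ls \<and> (\<forall>c\<in>set cs. sorted_wrt (<) c \<and> set c \<subseteq> {1..n}) \<and>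
     (\<forall>j i. Suc j < length cs \<longrightarrow> i < length (cs ! Suc j) \<longrightarrow> cs ! j ! i \<le> cs ! Suc j ! i)}"

lemma finite_ssyt: "finite (ssyt n ls)"
proof (rule finite_subset)
  let ?C = "{c. set c \<subseteq> {1..n} \<and> length c \<le> sum_list ls}"
  show "ssyt n ls \<subseteq> {cs. set cs \<subseteq> ?C \<and> length cs = length ls}"
    by (auto simp: ssyt_def member_le_sum_list)
  show "finite {cs. set cs \<subseteq> ?C \<and> length cs = length ls}"
    by (intro finite_lists_length_eq finite_lists_length_le) auto
qed

definition shape :: "nat \<Rightarrow> (nat \<Rightarrow> nat) \<Rightarrow> nat list" where
  "shape n m = map (col_len n m) [1..<Suc (part n m 1)]"

lemma length_shape [simp]: "length (shape n m) = part n m 1"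
  by (simp add: shape_def)

lemma nth_shape [simp]: "j < part n m 1 \<Longrightarrow> shape n m ! j = col_len n m (Suc j)"
  by (simp add: shape_def del: upt_Suc)

text \<open>A strictly increasing column \<open>c\<close> corresponds to the weakly decreasing column with entries
  \<open>n + i - c\<^sub>i\<close>. The latter is the sequence of the suffix maxima of a unique PBW column.\<close>

definition col_max :: "nat \<Rightarrow> nat list \<Rightarrow> nat \<Rightarrow> nat" where
  "col_max n c i = n + Suc i - c ! i"

text \<open>\<open>col_max\<close> stays constant exactly at a unit step of \<open>c\<close>; no new
  maximum arises there and the row holds its own number. The entry \<open>Suc n\<close> imagined
  after the last one stands for the suffix maximum \<open>length c\<close>, which own row numbers
  supply without a larger entry.\<close>

definition pbw_of_col :: "nat \<Rightarrow> nat list \<Rightarrow> nat \<Rightarrow> nat" where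
  "pbw_of_col n c i =
     (if (if Suc i < length c then c ! Suc i else Suc n) = Suc (c ! i) then Suc i else col_max n c i)"

context
  fixes n :: nat and c :: "nat list"
  assumes c: "sorted_wrt (<) c" "set c \<subseteq> {1..n}"
begin

lemma col_nth_ge: "i < length c \<Longrightarrow> Suc i \<le> c ! i"
proof (induction i)
  case 0
  then have "c ! 0 \<in> {1..n}" using c(2) nth_mem by blast
  then show ?case by simp
next
  case (Suc i)
  then show ?case using sorted_wrt_nth_less[OF c(1), of i "Suc i"] by auto
qed

text \<open>The entries after position \<open>i\<close> must still fit below or at \<open>n\<close>.
  In particular the subtraction in \<open>col_max\<close> never truncates.\<close>

lemma col_nth_le: "i < length c \<Longrightarrow> c ! i + length c \<le> n + Suc i"
proof (induction "length c - i" arbitrary: i rule: less_induct)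
  case less
  show ?case
  proof (cases "Suc i < length c")
    case True
    then have "c ! Suc i + length c \<le> n + Suc (Suc i)" by (intro less.hyps) auto
    then show ?thesis using True sorted_wrt_nth_less[OF c(1), of i "Suc i"] by auto
  next
    case False
    then have "length c = Suc i" using less.prems by simp
    moreover have "c ! i \<in> {1..n}" using c(2) nth_mem[OF less.prems] by blast
    ultimately show ?thesis by simp
  qed
qed

lemma col_max_bounds: "i < length c \<Longrightarrow> length c \<le> col_max n c i \<and> col_max n c i \<le> n"
  using col_nth_ge[of i] col_nth_le[of i] by (auto simp: col_max_def)

lemma col_max_Suc: "Suc i < length c \<Longrightarrow>
  col_max n c (Suc i) \<le> col_max n c i \<and> (c ! Suc i \<noteq> Suc (c ! i) \<longrightarrow> col_max n c (Suc i) < col_max n c i)"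
  using sorted_wrt_nth_less[OF c(1), of i "Suc i"] col_nth_le[of "Suc i"] col_nth_le[of i]
  by (auto simp: col_max_def)

lemma col_max_antimono: "i \<le> i' \<Longrightarrow> i' < length c \<Longrightarrow> col_max n c i' \<le> col_max n c i"
proof (induction i' rule: dec_induct)
  case (step i')
  then show ?case using col_max_Suc[of i'] by simp
qed simp

lemma pbw_of_col_le: "i < length c \<Longrightarrow> pbw_of_col n c i \<le> col_max n c i"
  using col_max_bounds[of i] by (auto simp: pbw_of_col_def)

lemma pbw_of_col_range: "i < length c \<Longrightarrow> pbw_of_col n c i \<in> {1..n}"
  using col_max_bounds[of i] by (auto simp: pbw_of_col_def)

text \<open>\<open>col_max\<close> is at least the length of the column, so it can equal the row
  number only in the last row with entry \<open>n\<close>; there both branches of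
  \<open>pbw_of_col\<close> agree.\<close>

lemma pbw_of_col_own:
  assumes "i < length c"
  shows "pbw_of_col n c i = Suc i \<longleftrightarrow> (if Suc i < length c then c ! Suc i else Suc n) = Suc (c ! i)"
proof
  assume *: "pbw_of_col n c i = Suc i"
  show "(if Suc i < length c then c ! Suc i else Suc n) = Suc (c ! i)"
  proof (rule ccontr)
    assume "\<not> ?thesis"
    with * have "col_max n c i = Suc i" by (auto simp: pbw_of_col_def split: if_splits)
    with \<open>\<not> ?thesis\<close> show False using col_max_bounds[of i] assms col_nth_le[of i] by (auto simp: col_max_def)
  qed
qed (simp add: pbw_of_col_def)

lemma pbw_of_col_not_own:
  assumes "i < length c" "pbw_of_col n c i \<noteq> Suc i"
  shows "pbw_of_col n c i = col_max n c i" "length c < col_max n c i"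
    "\<And>i'. i < i' \<Longrightarrow> i' < length c \<Longrightarrow> pbw_of_col n c i' < pbw_of_col n c i"
proof -
  show 1: "pbw_of_col n c i = col_max n c i" using assms by (auto simp: pbw_of_col_def)
  have nx: "(if Suc i < length c then c ! Suc i else Suc n) \<noteq> Suc (c ! i)"
    using assms pbw_of_col_own by blast
  show "length c < col_max n c i"
  proof (cases "Suc i < length c")
    case True
    then show ?thesis using col_max_Suc[OF True] col_max_bounds[OF True] nx by simp
  next
    case False
    then show ?thesis using nx assms col_max_bounds[of i] by (auto simp: col_max_def)
  qed
  fix i' assume i': "i < i'" "i' < length c"
  have "pbw_of_col n c i' \<le> col_max n c i'" using i' by (intro pbw_of_col_le)
  also have "\<dots> \<le> col_max n c (Suc i)" using i' by (intro col_max_antimono) auto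
  also have "\<dots> < col_max n c i" using col_max_Suc[of i] nx i' by auto
  finally show "pbw_of_col n c i' < pbw_of_col n c i" using 1 by simp
qed

text \<open>Along a run of unit steps \<open>col_max\<close> is constant, and the last row of the
  run holds this value. If the run reaches the bottom with entry \<open>n\<close>, the value is the
  last row number.\<close>

lemma pbw_of_col_max: "i < length c \<Longrightarrow> \<exists>i1\<ge>i. i1 < length c \<and> pbw_of_col n c i1 = col_max n c i"
proof (induction "length c - i" arbitrary: i rule: less_induct)
  case less
  show ?case
  proof (cases "(if Suc i < length c then c ! Suc i else Suc n) = Suc (c ! i)")
    case True
    show ?thesis
    proof (cases "Suc i < length c")
      case True2: True
      then have "col_max n c (Suc i) = col_max n c i" using True by (simp add: col_max_def)
      then show ?thesis using less.hyps[of "Suc i"] True2 by (metis Suc_leD diff_less_mono2 lessI less.prems)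
    next
      case False
      then have "pbw_of_col n c i = col_max n c i" using True less.prems by (auto simp: pbw_of_col_def col_max_def)
      then show ?thesis using less.prems by blast
    qed
  next
    case False
    then show ?thesis using less.prems by (auto simp: pbw_of_col_def)
  qed
qed

end

text \<open>Decoding from the bottom: an own row number reveals a unit step to the next entry, which
  is already known; any other entry is \<open>col_max\<close>, from which \<open>c ! i\<close> can
  be read off.\<close>

lemma pbw_of_col_inj:
  assumes c: "sorted_wrt (<) c" "set c \<subseteq> {1..n}" and c': "sorted_wrt (<) c'" "set c' \<subseteq> {1..n}"
    and len: "length c = length c'" and eq: "\<And>i. i < length c \<Longrightarrow> pbw_of_col n c i = pbw_of_col n c' i"
  shows "c = c'"
proof (rule nth_equalityI[OF len])
  fix i assume "i < length c"
  then show "c ! i = c' ! i"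
  proof (induction "length c - i" arbitrary: i rule: less_induct)
    case less
    have nx: "(if Suc i < length c then c ! Suc i else Suc n) = (if Suc i < length c' then c' ! Suc i else Suc n)"
      using less.hyps[of "Suc i"] len by auto
    show ?case
    proof (cases "pbw_of_col n c i = Suc i")
      case True
      then show ?thesis
        using pbw_of_col_own[OF c less.prems] pbw_of_col_own[OF c', of i] eq[OF less.prems] nx less.prems len
        by (metis Suc_inject)
    next
      case False
      then have "col_max n c i = col_max n c' i"
        using pbw_of_col_not_own(1)[OF c less.prems] pbw_of_col_not_own(1)[OF c', of i] eq[OF less.prems] less.prems len
        by simp
      then show ?thesis
        using col_nth_le[OF c less.prems] col_nth_le[OF c', of i] less.prems len by (auto simp: col_max_def)
    qed
  qed
qed

definition pbw_of :: "nat \<Rightarrow> (nat \<Rightarrow> nat) \<Rightarrow> nat list list \<Rightarrow> nat \<times> nat \<Rightarrow> nat" where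
  "pbw_of n m cs = (\<lambda>(i, j)\<in>diagram n m. pbw_of_col n (cs ! (j - 1)) (i - 1))"

lemma ssyt_shapeD:
  assumes "cs \<in> ssyt n (shape n m)" "1 \<le> j" "j \<le> part n m 1"
  shows "sorted_wrt (<) (cs ! (j - 1))" "set (cs ! (j - 1)) \<subseteq> {1..n}" "length (cs ! (j - 1)) = col_len n m j"
proof -
  have l: "map length cs = shape n m" using assms by (simp add: ssyt_def)
  then have "length cs = part n m 1" using length_shape by (metis length_map)
  then have j: "j - 1 < length cs" using assms by simp
  then show "sorted_wrt (<) (cs ! (j - 1))" "set (cs ! (j - 1)) \<subseteq> {1..n}"
    using assms by (auto simp: ssyt_def)
  show "length (cs ! (j - 1)) = col_len n m j"
    using arg_cong[OF l, of "\<lambda>l. l ! (j - 1)"] j assms by simp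
qed

text \<open>The entries of \<open>c\<close> are subtracted in \<open>col_max\<close>, so weak
  increase along the rows becomes weak decrease of suffix maxima. Each suffix maximum is attained in
  the same row or below, which provides the box that semistandardness asks for.\<close>

lemma pbw_of_semistandard:
  assumes cs: "cs \<in> ssyt n (shape n m)"
  shows "pbw_of n m cs \<in> semistandard_PBW n m"
proof -
  have val: "pbw_of n m cs (i, j) = pbw_of_col n (cs ! (j - 1)) (i - 1)" if "(i, j) \<in> diagram n m" for i j
    using that by (simp add: pbw_of_def)
  have col: "sorted_wrt (<) (cs ! (j - 1))" "set (cs ! (j - 1)) \<subseteq> {1..n}" "length (cs ! (j - 1)) = col_len n m j"
    "i - 1 < length (cs ! (j - 1))" "Suc (i - 1) = i"
    if "(i, j) \<in> diagram n m" for i j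
    using ssyt_shapeD[OF cs, of j] that diagramD[OF that] by (auto simp: diagram_iff)
  have "pbw_of n m cs \<in> PBW_tableaux n m"
    unfolding PBW_tableaux_def
  proof (intro CollectI conjI allI impI)
    show "pbw_of n m cs \<in> diagram n m \<rightarrow>\<^sub>E {1..n}"
    proof (rule PiE_I)
      fix x assume "x \<in> diagram n m"
      then show "pbw_of n m cs x \<in> {1..n}"
        using val pbw_of_col_range[OF col(1,2,4)] by (cases x) simp
    qed (simp add: pbw_of_def)
  next
    fix i j assume ij: "(i, j) \<in> diagram n m" and le: "pbw_of n m cs (i, j) \<le> col_len n m j"
    show "pbw_of n m cs (i, j) = i"
      using pbw_of_col_not_own(1,2)[OF col(1,2,4)[OF ij]] col(3,5)[OF ij] val[OF ij] le by fastforce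
  next
    fix i1 i2 j
    assume 1: "(i1, j) \<in> diagram n m" and 2: "(i2, j) \<in> diagram n m" and lt: "i1 < i2" and ne: "pbw_of n m cs (i1, j) \<noteq> i1"
    show "pbw_of n m cs (i2, j) < pbw_of n m cs (i1, j)"
      unfolding val[OF 1] val[OF 2]
      by (rule pbw_of_col_not_own(3)[OF col(1,2,4)[OF 1]])
         (use ne lt col(5)[OF 1] col(5)[OF 2] col(4)[OF 2] in \<open>auto simp: val[OF 1]\<close>)
  qed
  moreover have "\<exists>i1\<ge>i. (i1, j - 1) \<in> diagram n m \<and> pbw_of n m cs (i, j) \<le> pbw_of n m cs (i1, j - 1)"
    if ij: "(i, j) \<in> diagram n m" and j: "1 < j" for i j
  proof -
    let ?c = "cs ! (j - 1)" and ?c' = "cs ! (j - 1 - 1)"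
    have ij': "(i, j - 1) \<in> diagram n m" by (rule diagram_left[OF ij j])
    have jl: "Suc (j - 1 - 1) = j - 1" using j by simp
    have "length cs = part n m 1" using cs length_shape unfolding ssyt_def by (metis (mono_tags, lifting) length_map mem_Collect_eq)
    moreover have "cs ! j ! i \<le> cs ! Suc j ! i" if "Suc j < length cs" "i < length (cs ! Suc j)" for j i
      using cs that by (simp add: ssyt_def)
    from this[of "j - 1 - 1" "i - 1", unfolded jl]
    have "j - 1 < length cs \<Longrightarrow> ?c' ! (i - 1) \<le> ?c ! (i - 1)" using col(4)[OF ij] by blast
    ultimately have "?c' ! (i - 1) \<le> ?c ! (i - 1)" using diagramD[OF ij] by auto
    then have "col_max n ?c (i - 1) \<le> col_max n ?c' (i - 1)" unfolding col_max_def by (rule diff_le_mono2)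
    then have le: "pbw_of n m cs (i, j) \<le> col_max n ?c' (i - 1)"
      using pbw_of_col_le[OF col(1,2,4)[OF ij]] val[OF ij] by simp
    obtain i1 where i1: "i - 1 \<le> i1" "i1 < length ?c'" "pbw_of_col n ?c' i1 = col_max n ?c' (i - 1)"
      using pbw_of_col_max[OF col(1,2,4)[OF ij']] by blast
    have "(Suc i1, j - 1) \<in> diagram n m" using i1 col(3)[OF ij'] by (simp add: diagram_iff)
    moreover have "i \<le> Suc i1" using i1(1) by linarith
    ultimately show ?thesis using i1 le val[of "Suc i1" "j - 1"] by (intro exI[of _ "Suc i1"]) simp
  qed
  ultimately show ?thesis by (simp add: semistandard_PBW_def)
qed

lemma pbw_of_inj: "inj_on (pbw_of n m) (ssyt n (shape n m))"
proof (rule inj_onI)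
  fix cs cs' assume cs: "cs \<in> ssyt n (shape n m)" and cs': "cs' \<in> ssyt n (shape n m)"
    and eq: "pbw_of n m cs = pbw_of n m cs'"
  have l: "map length cs = shape n m" "map length cs' = shape n m" using cs cs' by (auto simp: ssyt_def)
  then have len: "length cs = part n m 1" "length cs' = part n m 1" using length_shape by (metis length_map)+
  show "cs = cs'"
  proof (rule nth_equalityI)
    fix j assume j: "j < length cs"
    have J: "1 \<le> Suc j" "Suc j \<le> part n m 1" using j len by auto
    note d = ssyt_shapeD[OF cs J] ssyt_shapeD[OF cs' J]
    show "cs ! j = cs' ! j"
    proof (rule pbw_of_col_inj[of _ n])
      fix i assume "i < length (cs ! j)"
      then have "(Suc i, Suc j) \<in> diagram n m" using d by (simp add: diagram_iff)
      then show "pbw_of_col n (cs ! j) i = pbw_of_col n (cs' ! j) i"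
        using fun_cong[OF eq, of "(Suc i, Suc j)"] by (simp add: pbw_of_def)
    qed (use d in simp_all)
  qed (use len in simp)
qed

lemma finite_semistandard_PBW: "finite (semistandard_PBW n m)"
proof -
  have "diagram n m \<subseteq> {..n} \<times> {..part n m 1}" using diagramD by fastforce
  then have "finite (diagram n m)" by (rule finite_subset) simp
  then have "finite (diagram n m \<rightarrow>\<^sub>E {1..n})" by (rule finite_PiE) simp
  then show ?thesis by (rule rev_finite_subset) (auto simp: semistandard_PBW_def PBW_tableaux_def)
qed

lemma card_ssyt_le: "card (ssyt n (shape n m)) \<le> card (semistandard_PBW n m)"
  by (rule card_inj_on_le[OF pbw_of_inj _ finite_semistandard_PBW]) (use pbw_of_semistandard in blast)

section \<open>Straightening and the basis\<close>

abbreviation (input) complex_ring :: "complex ring" where "complex_ring \<equiv> class_ring"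

section \<open>The quotient as a vector space\<close>

lemma flag_ring_simps:
  "carrier (flag_ring n D) = carrier (pl_ring n D Quot pl_ideal n D)"
  "zero (flag_ring n D) = pl_ideal n D"
  "add (flag_ring n D) = add (pl_ring n D Quot pl_ideal n D)"
  "(\<odot>\<^bsub>flag_ring n D\<^esub>) = (\<lambda>c x. pl_class n D (pl_const c) \<otimes>\<^bsub>pl_ring n D Quot pl_ideal n D\<^esub> x)"
  by (simp_all add: flag_ring_def Let_def FactRing_def)

lemma pl_class_hom: "ring_hom_ring (pl_ring n D) (pl_ring n D Quot pl_ideal n D) (pl_class n D)"
  unfolding pl_class_def by (rule ideal.rcos_ring_hom_ring[OF pl_ideal_ideal])

lemma pl_class_add:
  assumes "f \<in> carrier (pl_ring n D)" "g \<in> carrier (pl_ring n D)"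
  shows "pl_class n D (f + g) = pl_class n D f \<oplus>\<^bsub>flag_ring n D\<^esub> pl_class n D g"
  using ring_hom_add[OF ring_hom_ring.homh[OF pl_class_hom] assms]
  by (simp add: flag_ring_simps pl_ring_simps)

lemma pl_class_smult:
  assumes "f \<in> carrier (pl_ring n D)"
  shows "pl_class n D (pl_const c * f) = c \<odot>\<^bsub>flag_ring n D\<^esub> pl_class n D f"
  using ring_hom_mult[OF ring_hom_ring.homh[OF pl_class_hom] pl_const_closed assms]
  by (simp add: flag_ring_simps pl_ring_simps)

lemma pl_class_zero:
  assumes "f \<in> carrier (pl_ring n D)"
  shows "pl_class n D f = \<zero>\<^bsub>flag_ring n D\<^esub> \<longleftrightarrow> f \<in> pl_ideal n D"
proof -
  interpret I: ideal "pl_ideal n D" "pl_ring n D" by (rule pl_ideal_ideal)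
  show ?thesis
    using I.rcos_const_imp_mem[OF assms] I.a_rcos_const[of f] by (auto simp: flag_ring_simps pl_class_def)
qed

lemma pl_class_surj: "carrier (flag_ring n D) = pl_class n D ` carrier (pl_ring n D)"
  by (auto simp: flag_ring_simps FactRing_def A_RCOSETS_def' pl_class_def)

lemma pl_uminus_conv: "- f = pl_const (- 1) * f"
  using mult_map_scale_conv_mult[of "- 1 :: complex" f]
  by (intro poly_mapping_eqI) (simp add: pl_const_def lookup_const_mult)

text \<open>Linear combinations in the quotient take their coefficients from classes; injectivity
  prevents two members of \<open>G\<close> from being merged into one summand.\<close>

lemma lincomb_pl_class:
  assumes fin: "finite G" and G: "\<And>g. g \<in> G \<Longrightarrow> F g \<in> carrier (pl_ring n D)"
    and inj: "inj_on (\<lambda>g. pl_class n D (F g)) G"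
  shows "LinearCombinations.module.lincomb (flag_ring n D) a ((\<lambda>g. pl_class n D (F g)) ` G)
    = pl_class n D (\<Sum>g\<in>G. pl_const (a (pl_class n D (F g))) * F g)"
proof -
  interpret V: vectorspace complex_ring "flag_ring n D" by (rule flag_ring_vectorspace)
  let ?h = "\<lambda>g. pl_class n D (F g)"
  have cl: "?h g \<in> carrier (flag_ring n D)" if "g \<in> G" for g by (rule pl_class_closed[OF G[OF that]])
  have "V.lincomb a (?h ` G) = (\<Oplus>\<^bsub>flag_ring n D\<^esub>g\<in>G. a (?h g) \<odot>\<^bsub>flag_ring n D\<^esub> ?h g)"
    unfolding V.lincomb_def by (rule V.add.finprod_reindex[OF _ inj]) (use cl in \<open>auto simp: class_ring_simps\<close>)
  also have "\<dots> = pl_class n D (\<Sum>g\<in>G. pl_const (a (?h g)) * F g)"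
    using fin G cl
  proof (induction G rule: finite_induct)
    case empty
    have "0 \<in> pl_ideal n D"
      using additive_subgroup.zero_closed[OF ideal.axioms(1)[OF pl_ideal_ideal]] by (simp add: pl_ring_simps)
    then have "pl_class n D 0 = \<zero>\<^bsub>flag_ring n D\<^esub>"
      using pl_class_zero[OF pl_zero_closed] by blast
    then show ?case by simp
  next
    case (insert g G)
    have "(\<Oplus>\<^bsub>flag_ring n D\<^esub>g\<in>insert g G. a (?h g) \<odot>\<^bsub>flag_ring n D\<^esub> ?h g) =
        a (?h g) \<odot>\<^bsub>flag_ring n D\<^esub> ?h g \<oplus>\<^bsub>flag_ring n D\<^esub> (\<Oplus>\<^bsub>flag_ring n D\<^esub>g\<in>G. a (?h g) \<odot>\<^bsub>flag_ring n D\<^esub> ?h g)"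
      by (rule V.add.finprod_insert) (use insert in \<open>auto simp: class_ring_simps\<close>)
    also have "\<dots> = pl_class n D (pl_const (a (?h g)) * F g) \<oplus>\<^bsub>flag_ring n D\<^esub> pl_class n D (\<Sum>g\<in>G. pl_const (a (?h g)) * F g)"
      using insert by (simp add: pl_class_smult)
    also have "\<dots> = pl_class n D (pl_const (a (?h g)) * F g + (\<Sum>g\<in>G. pl_const (a (?h g)) * F g))"
      by (rule pl_class_add[symmetric]) (use insert in \<open>auto intro!: pl_mult_closed pl_const_closed pl_sum_closed\<close>)
    finally show ?case using insert by simp
  qed
  finally show ?thesis .
qed

text \<open>The preimage of a span under the quotient map, which lets straightening compute with
  polynomials instead of cosets.\<close>

definition pl_span :: "nat \<Rightarrow> nat set \<Rightarrow> pl_poly set set \<Rightarrow> pl_poly set" where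
  "pl_span n D S = {f \<in> carrier (pl_ring n D). pl_class n D f \<in> LinearCombinations.module.span complex_ring (flag_ring n D) S}"

context
  fixes n :: nat and D :: "nat set" and S :: "pl_poly set set"
  assumes S: "S \<subseteq> carrier (flag_ring n D)"
begin

lemma span_sub: "submodule complex_ring (LinearCombinations.module.span complex_ring (flag_ring n D) S) (flag_ring n D)"
proof -
  interpret V: vectorspace complex_ring "flag_ring n D" by (rule flag_ring_vectorspace)
  show ?thesis by (rule V.span_is_submodule[OF S])
qed

lemma pl_span_add: "f \<in> pl_span n D S \<Longrightarrow> g \<in> pl_span n D S \<Longrightarrow> f + g \<in> pl_span n D S"
  using submodule.m_closed[OF span_sub] by (auto simp: pl_span_def pl_class_add pl_add_closed)

lemma pl_span_scale: "f \<in> pl_span n D S \<Longrightarrow> pl_const c * f \<in> pl_span n D S"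
  using submodule.smult_closed[OF span_sub, of c]
  by (auto simp: pl_span_def pl_class_smult intro!: pl_mult_closed pl_const_closed)

lemma pl_span_uminus: "f \<in> pl_span n D S \<Longrightarrow> - f \<in> pl_span n D S"
  by (subst pl_uminus_conv) (rule pl_span_scale)

lemma pl_span_ideal: "f \<in> pl_ideal n D \<Longrightarrow> f \<in> pl_span n D S"
proof -
  assume f: "f \<in> pl_ideal n D"
  then have "f \<in> carrier (pl_ring n D)"
    using additive_subgroup.a_Hcarr[OF ideal.axioms(1)[OF pl_ideal_ideal]] by blast
  moreover from this have "pl_class n D f = \<zero>\<^bsub>flag_ring n D\<^esub>"
    using f pl_class_zero by blast
  ultimately show ?thesis using submodule.zero_closed[OF span_sub] by (simp add: pl_span_def)
qed

lemma pl_span_zero: "0 \<in> pl_span n D S"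
  using pl_span_ideal additive_subgroup.zero_closed[OF ideal.axioms(1)[OF pl_ideal_ideal, of n D]]
  by (simp add: pl_ring_simps)

lemma pl_span_sum: "(\<And>x. x \<in> A \<Longrightarrow> f x \<in> pl_span n D S) \<Longrightarrow> sum f A \<in> pl_span n D S"
  by (induction A rule: infinite_finite_induct) (auto intro: pl_span_add pl_span_zero)

lemma pl_span_sign: "f \<in> pl_span n D S \<Longrightarrow> (- 1) ^ k * f \<in> pl_span n D S"
  by (induction k) (auto intro: pl_span_uminus)

end

section \<open>Straightening of products of columns\<close>

definition PX_prod :: "nat list list \<Rightarrow> pl_poly" where
  "PX_prod cs = prod_list (map PX cs)"

lemma PX_prod_closed:
  "(\<And>c. c \<in> set cs \<Longrightarrow> set c \<subseteq> {1..n} \<and> length c \<in> D) \<Longrightarrow> PX_prod cs \<in> carrier (pl_ring n D)"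
proof (induction cs)
  case (Cons c cs)
  have "PX c \<in> carrier (pl_ring n D)" by (rule PX_closed) (use Cons.prems[of c] in simp_all)
  then show ?case using Cons by (simp add: PX_prod_def pl_mult_closed)
qed (simp add: PX_prod_def pl_one_closed)

lemma PX_sort: "distinct c \<Longrightarrow> PX c = (- 1) ^ card (inversions c) * PX (sort c)"
  by (simp add: PX_def inversions_sorted sorted_sort_id)

lemma PX_prod_sort:
  "(\<And>c. c \<in> set cs \<Longrightarrow> distinct c) \<Longrightarrow> \<exists>k. PX_prod cs = (- 1) ^ k * PX_prod (map sort cs)"
proof (induction cs)
  case Nil
  show ?case by (rule exI[of _ 0]) (simp add: PX_prod_def)
next
  case (Cons c cs)
  then obtain k where "PX_prod cs = (- 1) ^ k * PX_prod (map sort cs)" by auto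
  then have "PX_prod (c # cs) = (- 1) ^ (card (inversions c) + k) * PX_prod (map sort (c # cs))"
    using PX_sort[of c] Cons.prems by (simp add: PX_prod_def power_add algebra_simps)
  then show ?case by blast
qed

text \<open>A column without repetitions is read as the binary number with its entries as digit
  positions. This compares columns by their largest differing entry and ignores the order of the
  entries.\<close>

definition bin :: "nat list \<Rightarrow> nat" where
  "bin c = (\<Sum>x\<leftarrow>c. 2 ^ x)"

lemma bin_append: "bin (xs @ ys) = bin xs + bin ys"
  by (simp add: bin_def)

lemma bin_less:
  "sorted_wrt (<) c \<Longrightarrow> (\<And>x. x \<in> set c \<Longrightarrow> x \<le> b) \<Longrightarrow> bin c < 2 ^ Suc b"
proof (induction c arbitrary: b rule: rev_induct)
  case (snoc x c)
  have xb: "x \<le> b" using snoc.prems(2)[of x] by simp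
  show ?case
  proof (cases c)
    case Nil
    have "(2::nat) ^ x < 2 ^ Suc b" using xb by (intro power_strict_increasing) auto
    then show ?thesis using Nil by (simp add: bin_def)
  next
    case (Cons y ys)
    then have "0 < x" using snoc.prems by (auto simp: sorted_wrt_append)
    then have "bin c < 2 ^ Suc (x - 1)" using snoc.prems by (intro snoc.IH) (auto simp: sorted_wrt_append)
    then have "bin c < 2 ^ x" using \<open>0 < x\<close> by simp
    moreover have "(2::nat) ^ x \<le> 2 ^ b" using xb by (intro power_increasing) auto
    moreover have "bin (c @ [x]) = bin c + 2 ^ x" by (simp add: bin_def)
    ultimately show ?thesis unfolding power_Suc by linarith
  qed
qed (simp add: bin_def)

lemma bin_le: "set c \<subseteq> {1..n} \<Longrightarrow> bin c \<le> length c * 2 ^ n"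
  by (induction c) (auto simp: bin_def intro: add_mono)

lemma bin_sort: "bin (sort c) = bin c"
  unfolding bin_def by (metis mset_map mset_sort sum_mset_sum_list)

text \<open>The \<open>bin\<close> values of the columns are digits in base \<open>C\<close>, the
  rightmost column being the most significant.\<close>

fun potential :: "nat \<Rightarrow> nat list list \<Rightarrow> nat" where
  "potential C [] = 0"
| "potential C (c # cs) = bin c + C * potential C cs"

lemma potential_bound: "(\<And>c. c \<in> set cs \<Longrightarrow> bin c < C) \<Longrightarrow> potential C cs < C ^ length cs"
proof (induction cs)
  case (Cons c cs)
  then have "Suc (potential C cs) \<le> C ^ length cs" "bin c < C" by auto
  then have "C * Suc (potential C cs) \<le> C * C ^ length cs" by (intro mult_le_mono2)
  then show ?case using \<open>bin c < C\<close> by simp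
qed simp

lemma potential_sort: "potential C (map sort cs) = potential C cs"
  by (induction cs) (auto simp: bin_sort)

text \<open>An increase of the digit of \<open>J\<close> by at least 1 outweighs the complete loss
  of the digit of \<open>L\<close>, which is below the base.\<close>

lemma potential_less:
  assumes "bin L < C" "bin J < bin J'"
  shows "potential C (as @ L # J # bs) < potential C (as @ L' # J' # bs)"
proof (induction as)
  case Nil
  have "C * Suc (bin J) \<le> C * bin J'" using assms by (intro mult_le_mono2) simp
  then show ?case using assms by (simp add: algebra_simps)
next
  case (Cons a as)
  have "0 < C" using assms by simp
  then show ?case using Cons by simp
qed

lemma sorted_wrt_less_nth_ge: "sorted_wrt (<) r \<Longrightarrow> i < length r \<Longrightarrow> i \<le> r ! i" for r :: "nat list"
proof (induction i)
  case (Suc i)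
  then show ?case using sorted_wrt_nth_less[of "(<)" r i "Suc i"] by simp
qed simp

text \<open>At least one of the entries moved from \<open>L\<close> to \<open>J\<close> sits in a position \<open>\<ge> i\<close>, so it exceeds
  all the entries moved from \<open>J\<close> to \<open>L\<close>.\<close>

lemma bin_exch_J:
  assumes L: "sorted_wrt (<) L" and J: "sorted_wrt (<) J" and i: "i < length J"
    and lt: "J ! i < L ! i" and r: "r \<in> exch_idx (length L) (Suc i)"
  shows "bin J < bin (exch_J r L J)"
proof -
  have r': "sorted_wrt (<) r" "length r = Suc i" "set r \<subseteq> {..<length L}" using r by (auto simp: exch_idx_def)
  have "bin (take (Suc i) J) < 2 ^ Suc (J ! i)"
  proof (rule bin_less)
    show "sorted_wrt (<) (take (Suc i) J)" by (rule sorted_wrt_take[OF J])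
    fix x assume "x \<in> set (take (Suc i) J)"
    then obtain l where "l \<le> i" "x = J ! l" using i by (auto simp: in_set_conv_nth less_Suc_eq_le)
    then show "x \<le> J ! i" using sorted_wrt_nth_less[OF J, of l i] i by (cases "l = i") auto
  qed
  also have "(2::nat) ^ Suc (J ! i) \<le> 2 ^ (L ! (r ! i))"
  proof (rule power_increasing)
    have ri: "r ! i < length L" using r' by (auto simp: subset_eq)
    have "i \<le> r ! i" using r' by (intro sorted_wrt_less_nth_ge) auto
    then have "L ! i \<le> L ! (r ! i)"
      using sorted_wrt_nth_less[OF L, of i "r ! i"] ri by (cases "i = r ! i") auto
    then show "Suc (J ! i) \<le> L ! (r ! i)" using lt by simp
  qed simp
  also have "\<dots> \<le> bin (map ((!) L) r)"
    unfolding bin_def by (rule member_le_sum_list) (use r' in auto)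
  finally have "bin (take (Suc i) J) + bin (drop (Suc i) J) < bin (map ((!) L) r) + bin (drop (Suc i) J)" by simp
  moreover have "bin (take (Suc i) J) + bin (drop (Suc i) J) = bin J"
    by (simp add: bin_append[symmetric])
  ultimately show ?thesis using r' by (simp add: exch_J_def bin_append)
qed

lemma straightening:
  fixes n :: nat and D :: "nat set" and ls :: "nat list"
  defines "S \<equiv> (\<lambda>cs. pl_class n D (PX_prod cs)) ` ssyt n ls"
  assumes ls: "sorted_wrt (\<ge>) ls" "set ls \<subseteq> D"
    and cs: "map length cs = ls" "\<And>c. c \<in> set cs \<Longrightarrow> set c \<subseteq> {1..n}"
  shows "PX_prod cs \<in> pl_span n D S"
proof -
  have closed: "PX_prod cs \<in> carrier (pl_ring n D)" if "map length cs = ls" "\<And>c. c \<in> set cs \<Longrightarrow> set c \<subseteq> {1..n}" for cs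
    using that ls by (intro PX_prod_closed) auto
  have S: "S \<subseteq> carrier (flag_ring n D)"
    unfolding S_def
  proof (rule image_subsetI)
    fix cs assume "cs \<in> ssyt n ls"
    then have "map length cs = ls" "\<And>c. c \<in> set cs \<Longrightarrow> set c \<subseteq> {1..n}" by (simp_all add: ssyt_def)
    then show "pl_class n D (PX_prod cs) \<in> carrier (flag_ring n D)" by (intro pl_class_closed closed)
  qed
  \<comment> \<open>This exceeds \<open>bin\<close> of every column, as a column has at most
    \<open>sum_list ls\<close> entries and each contributes at most \<open>2 ^ n\<close>.\<close>
  define C where "C = Suc (sum_list ls * 2 ^ n)"
  have binC: "bin c < C" if "c \<in> set cs" "map length cs = ls" "set c \<subseteq> {1..n}" for c cs
  proof -
    have "length c \<le> sum_list ls" using that by (auto intro: member_le_sum_list)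
    then have "length c * 2 ^ n \<le> sum_list ls * 2 ^ n" by (rule mult_le_mono1)
    then have "bin c \<le> sum_list ls * 2 ^ n" by (rule order_trans[OF bin_le[OF that(3)]])
    then show ?thesis by (simp add: C_def)
  qed
  show ?thesis
    using cs
  proof (induction "C ^ length ls - potential C cs" arbitrary: cs rule: less_induct)
    case less
    show ?case
    proof (cases "\<forall>c\<in>set cs. distinct c")
      case False
      then obtain c where "c \<in> set cs" "PX c = 0" by (auto simp: PX_def)
      then have "0 \<in> set (map PX cs)" by force
      then have "PX_prod cs = 0" unfolding PX_prod_def by (induction cs) auto
      then show ?thesis by (simp add: pl_span_zero[OF S])
    next
      case True
      define ss where "ss = map sort cs"
      have sorted: "sorted_wrt (<) c \<and> set c \<subseteq> {1..n}" if c: "c \<in> set ss" for c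
      proof -
        obtain d where "d \<in> set cs" "c = sort d" using c by (auto simp: ss_def)
        then show ?thesis using less.prems(2)[of d] True by (simp add: strict_sorted_iff)
      qed
      have ss: "map length ss = ls" "\<And>c. c \<in> set ss \<Longrightarrow> sorted_wrt (<) c \<and> set c \<subseteq> {1..n}"
        "potential C ss = potential C cs"
        using less.prems(1) sorted by (simp_all add: ss_def potential_sort comp_def)
      obtain k where k: "PX_prod cs = (- 1) ^ k * PX_prod ss"
        using PX_prod_sort[of cs] True unfolding ss_def by blast
      have "PX_prod ss \<in> pl_span n D S"
      proof (cases "ss \<in> ssyt n ls")
        case True
        then have "pl_class n D (PX_prod ss) \<in> S" by (auto simp: S_def)
        moreover have "S \<subseteq> LinearCombinations.module.span complex_ring (flag_ring n D) S"
          using LinearCombinations.module.in_own_span[OF vectorspace.axioms(1)[OF flag_ring_vectorspace] S] .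
        ultimately show ?thesis using closed[OF ss(1)] ss(2) by (auto simp: pl_span_def)
      next
        case False
        then obtain j i where j: "Suc j < length ss" and i: "i < length (ss ! Suc j)"
          and lt: "ss ! Suc j ! i < ss ! j ! i"
          using ss by (auto simp: ssyt_def not_le)
        define as bs L J where "as = take j ss" and "bs = drop (Suc (Suc j)) ss" and "L = ss ! j" and "J = ss ! Suc j"
        have split: "ss = as @ L # J # bs"
          using j by (simp add: as_def bs_def L_def J_def Cons_nth_drop_Suc id_take_nth_drop[symmetric])
        have L: "sorted_wrt (<) L" "set L \<subseteq> {1..n}" and J: "sorted_wrt (<) J" "set J \<subseteq> {1..n}"
          using ss(2) split by auto
        have lss: "length ls = length ss" using ss(1) by auto
        have lenLJ: "length L = ls ! j" "length J = ls ! Suc j"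
          using ss(1) j by (auto simp: L_def J_def)
        then have len: "length J \<le> length L"
          using sorted_wrt_nth_less[OF ls(1), of j "Suc j"] j lss by simp
        have lD: "length L \<in> D" "length J \<in> D"
          using ls(2) nth_mem[of j ls] nth_mem[of "Suc j" ls] j lss by (auto simp: lenLJ)
        have iJ: "i < length J" using i by (simp add: J_def)
        have ltLJ: "J ! i < L ! i" using lt by (simp add: L_def J_def)
        have in_ss: "set as \<subseteq> set ss" "set bs \<subseteq> set ss"
          by (simp_all add: as_def bs_def set_take_subset set_drop_subset)
        have inD: "set c \<subseteq> {1..n} \<and> length c \<in> D" if "c \<in> set ss" for c
          using ss(2)[OF that] that ls(2) arg_cong[OF ss(1), of set] by auto
        define P where "P = PX_prod as * PX_prod bs"
        have P: "P \<in> carrier (pl_ring n D)"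
          unfolding P_def using inD in_ss by (intro pl_mult_closed PX_prod_closed) blast+
        \<comment> \<open>The exchanged part of \<open>J\<close> ends with the violating entry;
          positions count from 0, so it has \<open>Suc i\<close> entries.\<close>
        have "pl_rel (Suc i) L J \<in> pl_rels n D"
          unfolding pl_rels_def using lD len iJ L J
          by (intro CollectI exI[of _ "Suc i"] exI[of _ L] exI[of _ J]) simp
        then have "pl_rel (Suc i) L J \<in> pl_ideal n D"
          unfolding pl_ideal_def using ring.genideal_self[OF cring.axioms(1)[OF pl_ring_cring] pl_rels_carrier] by blast
        from ideal.I_l_closed[OF pl_ideal_ideal this P]
        have rel: "P * pl_rel (Suc i) L J \<in> pl_span n D S"
          by (intro pl_span_ideal[OF S]) (simp add: pl_ring_simps)
        have summand: "P * (PX (exch_L r L J) * PX (exch_J r L J)) \<in> pl_span n D S"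
          if r: "r \<in> exch_idx (length L) (Suc i)" for r
        proof -
          have r': "length r = Suc i" "set r \<subseteq> {..<length L}" using r by (auto simp: exch_idx_def)
          define ns where "ns = as @ exch_L r L J # exch_J r L J # bs"
          have ex_L: "set (exch_L r L J) \<subseteq> set L \<union> set J"
            unfolding exch_L_def by (rule conjunct2[OF exch_L_aux]) (use r' iJ in auto)
          have ex_J: "set (exch_J r L J) \<subseteq> set L \<union> set J"
            using r' set_drop_subset[of "length r" J] by (auto simp: exch_J_def)
          have ns_set: "set c \<subseteq> {1..n}" if "c \<in> set ns" for c
          proof -
            have "c \<in> set ss \<or> c = exch_L r L J \<or> c = exch_J r L J"
              using that in_ss by (auto simp: ns_def)
            then show ?thesis using ss(2) ex_L ex_J L(2) J(2) by blast
          qed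
          have ns_len: "map length ns = ls"
            using ss(1)[symmetric] arg_cong[OF split, of "map length"] r' iJ
            by (simp add: ns_def exch_L_eq exch_J_def)
          have bL: "bin L < C" by (rule binC[OF _ ss(1) L(2)]) (use j in \<open>simp add: L_def\<close>)
          have "potential C ss < potential C ns"
            unfolding ns_def by (subst split) (rule potential_less[OF bL bin_exch_J[OF L(1) J(1) iJ ltLJ r]])
          moreover have "potential C ns < C ^ length ns"
            by (rule potential_bound) (rule binC[OF _ ns_len ns_set])
          moreover have "length ns = length ls" using arg_cong[OF ns_len, of length] by simp
          ultimately have "C ^ length ls - potential C ns < C ^ length ls - potential C cs"
            using ss(3) by simp
          then have "PX_prod ns \<in> pl_span n D S" using ns_len ns_set by (rule less.hyps)
          then show ?thesis by (simp add: ns_def P_def PX_prod_def mult_ac)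
        qed
        have "PX_prod ss = P * (PX L * PX J)"
          unfolding P_def PX_prod_def by (subst split) (simp add: mult_ac)
        also have "\<dots> = P * pl_rel (Suc i) L J + (\<Sum>r\<in>exch_idx (length L) (Suc i). P * (PX (exch_L r L J) * PX (exch_J r L J)))"
          unfolding pl_rel_def sum_distrib_left[symmetric] distrib_left[symmetric] by simp
        finally show ?thesis
          using pl_span_add[OF S rel pl_span_sum[OF S summand]] by simp
      qed
      then show ?thesis unfolding k by (rule pl_span_sign[OF S])
    qed
  qed
qed

section \<open>Shapes, weights and monomials\<close>

lemma X_tab_eq: "X_tab n m T = PX_prod (map (column n m T) [1..<Suc (part n m 1)])"
proof -
  have "prod_list (map (\<lambda>j. PX (column n m T j)) [1..<Suc (part n m 1)]) = (\<Prod>j\<in>set [1..<Suc (part n m 1)]. PX (column n m T j))"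
    by (rule prod.distinct_set_conv_list[symmetric]) simp
  then show ?thesis
    by (simp add: X_tab_def PX_prod_def comp_def atLeastLessThanSuc_atLeastAtMost del: upt_Suc)
qed

lemma shape_sorted: "sorted_wrt (\<ge>) (shape n m)"
  unfolding sorted_wrt_iff_nth_less using col_len_antimono by simp

lemma shape_subset: "1 < n \<Longrightarrow> m \<in> P_plus D \<Longrightarrow> set (shape n m) \<subseteq> D"
  by (auto simp: shape_def intro!: col_len_in simp del: upt_Suc)

lemma column_range: "T \<in> PBW_tableaux n m \<Longrightarrow> set (column n m T j) \<subseteq> {1..n}"
proof -
  assume T: "T \<in> PBW_tableaux n m"
  have "column n m T j ! i \<in> {1..n}" if "i < col_len n m j" for i
    using that PBW_range[OF T, of "Suc i" j] by (simp add: diagram_iff)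
  then show ?thesis by (auto simp: in_set_conv_nth)
qed

lemma X_tab_closed:
  assumes "1 < n" "m \<in> P_plus D" "T \<in> PBW_tableaux n m"
  shows "X_tab n m T \<in> carrier (pl_ring n D)"
  unfolding X_tab_eq
  by (rule PX_prod_closed) (use assms column_range[OF assms(3)] in \<open>auto intro!: col_len_in simp del: upt_Suc\<close>)

lemma length_filter_le_iff:
  "sorted_wrt (\<ge>) ls \<Longrightarrow> j < length ls \<Longrightarrow> j < length (filter (\<lambda>l. i \<le> l) ls) \<longleftrightarrow> i \<le> ls ! j" for ls :: "nat list"
proof (induction ls arbitrary: j)
  case (Cons a ls)
  show ?case
  proof (cases "i \<le> a")
    case True
    then show ?thesis using Cons by (cases j) auto
  next
    case False
    then have "\<forall>l\<in>set (a # ls). \<not> i \<le> l" using Cons.prems by auto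
    then have "filter (\<lambda>l. i \<le> l) (a # ls) = []" "\<not> i \<le> (a # ls) ! j"
      using nth_mem[OF Cons.prems(2)] by (simp_all only: filter_empty_conv) blast+
    then show ?thesis by simp
  qed
qed simp

lemma sum_count_list: "finite A \<Longrightarrow> (\<Sum>k\<in>A. count_list ls k) = length (filter (\<lambda>l. l \<in> A) ls)"
proof (induction ls)
  case (Cons a ls)
  have "(\<Sum>k\<in>A. count_list (a # ls) k) = (\<Sum>k\<in>A. count_list ls k + (if k = a then 1 else 0))"
    by (rule sum.cong) auto
  also have "\<dots> = (\<Sum>k\<in>A. count_list ls k) + (if a \<in> A then 1 else 0)"
    using Cons.prems by (simp add: sum.distrib)
  finally show ?case using Cons by simp
qed simp

text \<open>The coefficient at \<open>k\<close> is the number of columns of length \<open>k\<close>.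
  Row \<open>i\<close> then counts the columns of length at least \<open>i\<close>, and in a weakly
  decreasing list these form a prefix.\<close>

lemma shape_exists:
  assumes D: "D \<subseteq> {1..n - 1}" and ls: "sorted_wrt (\<ge>) ls" "set ls \<subseteq> D"
  shows "count_list ls \<in> P_plus D \<and> shape n (count_list ls) = ls"
proof -
  let ?m = "count_list ls"
  have range: "1 \<le> l \<and> l \<le> n - 1" if "l \<in> set ls" for l using that D ls by auto
  have part: "part n ?m i = length (filter (\<lambda>l. i \<le> l) ls)" for i
    unfolding part_def using range by (subst sum_count_list) (auto intro!: arg_cong[of _ _ length] filter_cong)
  have p1: "part n ?m 1 = length ls"
    unfolding part using range by (simp add: filter_True)
  have col: "col_len n ?m (Suc j) = ls ! j" if j: "j < length ls" for j
  proof -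
    have r: "1 \<le> ls ! j" "ls ! j \<le> n - 1" using range j by auto
    have pj: "Suc j \<le> part n ?m i \<longleftrightarrow> i \<le> ls ! j" for i
      unfolding part Suc_le_eq by (rule length_filter_le_iff[OF ls(1) j])
    have "i \<in> {i. (i, Suc j) \<in> diagram n ?m} \<longleftrightarrow> i \<in> {1..ls ! j}" for i
      unfolding diagram_def mem_Collect_eq case_prod_conv atLeastAtMost_iff pj
      using r by (intro iffI conjI; elim conjE; linarith)
    then have "{i. (i, Suc j) \<in> diagram n ?m} = {1..ls ! j}" by (rule Set.set_eqI)
    then show ?thesis by (simp add: col_len_def)
  qed
  have "shape n ?m = ls"
    by (rule nth_equalityI) (use p1 col in auto)
  moreover have "?m \<in> P_plus D" using ls by (auto simp: P_plus_def count_list_0_iff)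
  ultimately show ?thesis by simp
qed

lemma single_power: "Poly_Mapping.single (Poly_Mapping.single J 1) (1::complex) ^ k = Poly_Mapping.single (Poly_Mapping.single J k) 1"
  for J :: "nat list"
  by (induction k) (auto simp: mult_single single_add[symmetric])

text \<open>Exponents become repeated factors. They are ordered by decreasing length so that they
  can serve as the columns of a diagram.\<close>

lemma monomial_PX_prod:
  assumes e: "Poly_Mapping.keys e \<subseteq> pl_vars n D"
  obtains cs where "set cs \<subseteq> pl_vars n D" "sorted_wrt (\<ge>) (map length cs)" "Poly_Mapping.single e 1 = PX_prod cs"
proof -
  obtain xs where xs: "set xs = Poly_Mapping.keys e" "distinct xs"
    using finite_distinct_list[of "Poly_Mapping.keys e"] by auto
  define ds where "ds = concat (map (\<lambda>J. replicate (Poly_Mapping.lookup e J) J) xs)"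
  have PXJ: "PX J = Poly_Mapping.single (Poly_Mapping.single J 1) 1" if "J \<in> pl_vars n D" for J
    using that by (simp add: pl_vars_def PX_def strict_sorted_iff inversions_sorted sorted_sort_id)
  have "PX_prod ds = (\<Prod>J\<leftarrow>xs. PX J ^ Poly_Mapping.lookup e J)"
    unfolding ds_def PX_prod_def by (induction xs) (auto simp: prod_list_replicate)
  also have "\<dots> = (\<Prod>J\<in>Poly_Mapping.keys e. PX J ^ Poly_Mapping.lookup e J)"
    by (simp only: xs(1)[symmetric] prod.distinct_set_conv_list[OF xs(2)])
  also have "\<dots> = (\<Prod>J\<in>Poly_Mapping.keys e. Poly_Mapping.single (Poly_Mapping.single J (Poly_Mapping.lookup e J)) 1)"
    by (rule prod.cong[OF refl]) (use e PXJ single_power in auto)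
  also have "\<dots> = Poly_Mapping.single e 1"
    by (subst prod_single_one) (simp_all add: poly_mapping_sum_single[symmetric])
  finally have ds: "PX_prod ds = Poly_Mapping.single e 1" .
  define cs where "cs = rev (sort_key length ds)"
  have "mset cs = mset ds" by (simp add: cs_def)
  then have "PX_prod cs = PX_prod ds"
    unfolding PX_prod_def by (metis mset_map prod_mset_prod_list)
  moreover have "set cs \<subseteq> pl_vars n D"
    using e xs by (auto simp: cs_def ds_def)
  moreover have "sorted_wrt (\<ge>) (map length cs)"
    by (simp add: cs_def rev_map[symmetric] sorted_wrt_rev)
  ultimately show thesis using that ds by metis
qed

section \<open>The classes of semistandard PBW-tableaux\<close>

definition tab_index :: "nat \<Rightarrow> nat set \<Rightarrow> ((nat \<Rightarrow> nat) \<times> (nat \<times> nat \<Rightarrow> nat)) set" where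
  "tab_index n D = (SIGMA m : P_plus D. semistandard_PBW n m)"

definition tab_class :: "nat \<Rightarrow> nat set \<Rightarrow> (nat \<Rightarrow> nat) \<times> (nat \<times> nat \<Rightarrow> nat) \<Rightarrow> pl_poly set" where
  "tab_class n D g = pl_class n D (X_tab n (fst g) (snd g))"

context
  fixes n :: nat and D :: "nat set"
  assumes n: "1 < n" and D: "D \<subseteq> {1..n - 1}"
begin

lemma tab_indexD:
  assumes "g \<in> tab_index n D"
  shows "fst g \<in> P_plus D" "snd g \<in> semistandard_PBW n (fst g)" "snd g \<in> PBW_tableaux n (fst g)"
    "X_tab n (fst g) (snd g) \<in> carrier (pl_ring n D)"
    "lowest (pl_eval minor (X_tab n (fst g) (snd g))) (tab_mon n (fst g) (snd g))"
proof -
  show *: "fst g \<in> P_plus D" "snd g \<in> semistandard_PBW n (fst g)" using assms by (auto simp: tab_index_def)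
  then show **: "snd g \<in> PBW_tableaux n (fst g)" by (simp add: semistandard_PBW_def)
  show "X_tab n (fst g) (snd g) \<in> carrier (pl_ring n D)" by (rule X_tab_closed[OF n *(1) **])
  show "lowest (pl_eval minor (X_tab n (fst g) (snd g))) (tab_mon n (fst g) (snd g))"
    by (rule lowest_X_tab[OF **])
qed

lemma tab_mon_inj_on: "inj_on (\<lambda>g. tab_mon n (fst g) (snd g)) (tab_index n D)"
proof (rule inj_onI)
  fix g h assume g: "g \<in> tab_index n D" and h: "h \<in> tab_index n D"
    and eq: "tab_mon n (fst g) (snd g) = tab_mon n (fst h) (snd h)"
  have "fst g = fst h"
    by (rule tab_mon_weight_eq[OF tab_indexD(1)[OF g] tab_indexD(1)[OF h] D tab_indexD(3)[OF g] tab_indexD(3)[OF h] eq])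
  moreover from this have "snd g = snd h"
    using tab_mon_inj[of "snd g" n "fst g" "snd h"] tab_indexD(2)[OF g] tab_indexD(2)[OF h] eq by simp
  ultimately show "g = h" by (rule prod_eqI)
qed

text \<open>Equal classes differ by an element of the ideal, so the evaluations agree, and with them
  the lowest monomials.\<close>

lemma tab_class_inj: "inj_on (tab_class n D) (tab_index n D)"
proof (rule inj_onI)
  fix g h assume g: "g \<in> tab_index n D" and h: "h \<in> tab_index n D"
    and eq: "tab_class n D g = tab_class n D h"
  let ?X = "\<lambda>g. X_tab n (fst g) (snd g)"
  interpret R: cring "pl_ring n D" by (rule pl_ring_cring)
  interpret I: ideal "pl_ideal n D" "pl_ring n D" by (rule pl_ideal_ideal)
  have "?X g \<in> pl_ideal n D +>\<^bsub>pl_ring n D\<^esub> ?X h"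
    using I.a_rcos_self[OF tab_indexD(4)[OF g]] eq by (simp add: tab_class_def pl_class_def)
  then obtain f where "f \<in> pl_ideal n D" "?X g = f + ?X h"
    by (auto simp: a_r_coset_def' pl_ring_simps)
  then have "pl_eval minor (?X g) = pl_eval minor (?X h)" by (simp add: pl_eval_add pl_eval_ideal)
  then have "tab_mon n (fst g) (snd g) = tab_mon n (fst h) (snd h)"
    using lowest_unique tab_indexD(5)[OF g] tab_indexD(5)[OF h] by metis
  then show "g = h" using tab_mon_inj_on g h by (auto dest: inj_onD)
qed

lemma tab_class_closed: "tab_class n D ` tab_index n D \<subseteq> carrier (flag_ring n D)"
  unfolding tab_class_def using tab_indexD(4) pl_class_closed by blast

text \<open>A dependence among classes lifts, with the same coefficients, to a polynomial in the
  ideal. Evaluation turns it into a dependence among products of minors with distinct lowest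
  monomials.\<close>

lemma tab_class_independent:
  assumes "B \<subseteq> tab_class n D ` tab_index n D"
  shows "\<not> LinearCombinations.module.lin_dep complex_ring (flag_ring n D) B"
proof
  interpret V: vectorspace complex_ring "flag_ring n D" by (rule flag_ring_vectorspace)
  let ?X = "\<lambda>g. X_tab n (fst g) (snd g)"
  assume "V.lin_dep B"
  then obtain A a v where A: "finite A" "A \<subseteq> B" "V.lincomb a A = \<zero>\<^bsub>flag_ring n D\<^esub>" "v \<in> A" "a v \<noteq> 0"
    unfolding V.lin_dep_def by (auto simp: class_ring_simps)
  obtain G where G: "finite G" "G \<subseteq> tab_index n D" "A = tab_class n D ` G"
    using finite_subset_image[OF A(1)] A(2) assms by (metis order_trans)
  have inj: "inj_on (tab_class n D) G" using tab_class_inj G(2) by (rule inj_on_subset)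
  have cl: "?X g \<in> carrier (pl_ring n D)" if "g \<in> G" for g using tab_indexD(4) that G by blast
  let ?f = "\<Sum>g\<in>G. pl_const (a (tab_class n D g)) * ?X g"
  have "pl_class n D ?f = \<zero>\<^bsub>flag_ring n D\<^esub>"
    using lincomb_pl_class[OF G(1) cl inj[unfolded tab_class_def[abs_def]]] A(3) unfolding G(3) tab_class_def by simp
  moreover have "?f \<in> carrier (pl_ring n D)"
    using cl by (intro pl_sum_closed pl_mult_closed pl_const_closed)
  ultimately have "pl_eval minor ?f = 0" using pl_class_zero pl_eval_ideal by blast
  then have zero: "(\<Sum>g\<in>G. Poly_Mapping.single 0 (a (tab_class n D g)) * pl_eval minor (?X g)) = 0"
    by (simp add: pl_eval_sum pl_eval_mult)
  obtain g where g: "g \<in> G" "v = tab_class n D g" using A(4) G(3) by blast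
  have "a (tab_class n D g) = 0"
    by (rule lowest_independent[OF G(1) _ _ zero g(1)])
       (use tab_indexD(5) G(2) inj_on_subset[OF tab_mon_inj_on] in auto)
  then show False using A(5) g by simp
qed

text \<open>The columns of a PBW-tableau are admissible input for \<open>straightening\<close>, so
  \<open>?B\<close> lies in the span of \<open>?A\<close>. It is independent and has at least as
  many elements as \<open>?A\<close>, which leaves no room for a larger span.\<close>

lemma weight_space_span:
  assumes m: "m \<in> P_plus D"
  shows "LinearCombinations.module.span complex_ring (flag_ring n D) ((\<lambda>cs. pl_class n D (PX_prod cs)) ` ssyt n (shape n m))
    = LinearCombinations.module.span complex_ring (flag_ring n D) (tab_class n D ` Pair m ` semistandard_PBW n m)"
proof -
  interpret V: vectorspace complex_ring "flag_ring n D" by (rule flag_ring_vectorspace)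
  let ?A = "(\<lambda>cs. pl_class n D (PX_prod cs)) ` ssyt n (shape n m)"
  let ?B = "tab_class n D ` Pair m ` semistandard_PBW n m"
  have sub: "Pair m ` semistandard_PBW n m \<subseteq> tab_index n D" using m by (auto simp: tab_index_def)
  have finA: "finite ?A" by (intro finite_imageI finite_ssyt)
  have finB: "finite ?B" by (intro finite_imageI finite_semistandard_PBW)
  note sh = shape_sorted[of n m] shape_subset[OF n m]
  have A: "?A \<subseteq> carrier (flag_ring n D)"
  proof (rule image_subsetI)
    fix cs assume cs: "cs \<in> ssyt n (shape n m)"
    then have l: "map length cs = shape n m" by (simp add: ssyt_def)
    have "length c \<in> D" if "c \<in> set cs" for c
      using that sh(2) arg_cong[OF l, of set] by auto
    then show "pl_class n D (PX_prod cs) \<in> carrier (flag_ring n D)"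
      using cs by (intro pl_class_closed PX_prod_closed) (simp add: ssyt_def)
  qed
  have li: "\<not> V.lin_dep ?B" by (rule tab_class_independent) (use sub in blast)
  have BA: "?B \<subseteq> V.span ?A"
  proof
    fix x assume "x \<in> ?B"
    then obtain T where T: "T \<in> semistandard_PBW n m" "x = pl_class n D (X_tab n m T)"
      by (auto simp: tab_class_def)
    then have "T \<in> PBW_tableaux n m" by (simp add: semistandard_PBW_def)
    have "X_tab n m T \<in> pl_span n D ?A"
      unfolding X_tab_eq
      by (rule straightening[OF sh]) (use column_range[OF \<open>T \<in> PBW_tableaux n m\<close>] in \<open>auto simp: shape_def comp_def simp del: upt_Suc\<close>)
    then show "x \<in> V.span ?A" using T by (simp add: pl_span_def)
  qed
  have "card ?B = card (semistandard_PBW n m)"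
    using card_image[OF inj_on_subset[OF tab_class_inj sub]] by (simp add: card_image inj_on_def)
  moreover have "card ?A \<le> card (ssyt n (shape n m))" by (rule card_image_le[OF finite_ssyt])
  ultimately have card: "card ?A \<le> card ?B" using card_ssyt_le[of n m] by simp
  \<comment> \<open>\<open>C\<close> completes \<open>?B\<close> to a generating set; the integer
    bound on its size is at most 0, so \<open>C\<close> is empty.\<close>
  obtain C where C: "finite C" "int (card C) \<le> int (card ?A) - int (card ?B)" "V.span (?B \<union> C) = V.span ?A"
    using V.replacement[OF finB finA A li BA] by blast
  then have "card C = 0" using card by linarith
  then have "C = {}" using C(1) by simp
  then show ?thesis using C(3) by simp
qed

text \<open>Every monomial is a product of columns of some shape and thus lies in the weight space
  of the corresponding weight, where \<open>weight_space_span\<close> applies.\<close>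

lemma tab_class_span: "LinearCombinations.module.span complex_ring (flag_ring n D) (tab_class n D ` tab_index n D) = carrier (flag_ring n D)"
proof
  interpret V: vectorspace complex_ring "flag_ring n D" by (rule flag_ring_vectorspace)
  let ?B = "tab_class n D ` tab_index n D"
  show "V.span ?B \<subseteq> carrier (flag_ring n D)" by (rule V.span_is_subset2[OF tab_class_closed])
  have e: "Poly_Mapping.single e 1 \<in> pl_span n D ?B" if keys: "Poly_Mapping.keys e \<subseteq> pl_vars n D" for e
  proof -
    obtain cs where cs: "set cs \<subseteq> pl_vars n D" "sorted_wrt (\<ge>) (map length cs)" "Poly_Mapping.single e 1 = PX_prod cs"
      using monomial_PX_prod[OF keys] by blast
    define ls where "ls = map length cs"
    have ls: "sorted_wrt (\<ge>) ls" "set ls \<subseteq> D" using cs by (auto simp: ls_def pl_vars_def)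
    obtain m where m: "m \<in> P_plus D" "shape n m = ls" using shape_exists[OF D ls] by blast
    have "PX_prod cs \<in> pl_span n D ((\<lambda>cs. pl_class n D (PX_prod cs)) ` ssyt n ls)"
      by (rule straightening[OF ls]) (use cs in \<open>auto simp: ls_def pl_vars_def\<close>)
    then have "PX_prod cs \<in> pl_span n D (tab_class n D ` Pair m ` semistandard_PBW n m)"
      using weight_space_span[OF m(1)] m(2) by (simp add: pl_span_def)
    moreover have "tab_class n D ` Pair m ` semistandard_PBW n m \<subseteq> ?B" using m by (auto simp: tab_index_def)
    ultimately show ?thesis unfolding cs(3) pl_span_def using V.span_is_monotone by blast
  qed
  show "carrier (flag_ring n D) \<subseteq> V.span ?B"
  proof
    fix x assume "x \<in> carrier (flag_ring n D)"
    then obtain f where f: "f \<in> carrier (pl_ring n D)" "x = pl_class n D f" by (auto simp: pl_class_surj)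
    have "(\<Sum>e\<in>Poly_Mapping.keys f. pl_const (Poly_Mapping.lookup f e) * Poly_Mapping.single e 1) \<in> pl_span n D ?B"
      by (intro pl_span_sum[OF tab_class_closed] pl_span_scale[OF tab_class_closed] e)
         (use f in \<open>auto simp: pl_carrier_iff\<close>)
    then have "f \<in> pl_span n D ?B"
      by (simp add: pl_const_def mult_single poly_mapping_sum_single[symmetric])
    then show "x \<in> V.span ?B" using f by (simp add: pl_span_def)
  qed
qed

end

theorem proposition4p12:
  fixes n :: nat and D :: "nat set"
  assumes "n \<ge> 2" and "D \<noteq> {}" and "D \<subseteq> {1..n - 1}"
  shows "inj_on (\<lambda>(m, T). pl_class n D (X_tab n m T)) (SIGMA m : P_plus D. semistandard_PBW n m)
    \<and> vectorspace.basis (class_ring :: complex ring) (flag_ring n D)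
        ((\<lambda>(m, T). pl_class n D (X_tab n m T)) ` (SIGMA m : P_plus D. semistandard_PBW n m))"
proof -
  have n: "1 < n" using assms by simp
  have eq: "(\<lambda>(m, T). pl_class n D (X_tab n m T)) = tab_class n D"
    by (auto simp: tab_class_def fun_eq_iff)
  show ?thesis
    unfolding eq tab_index_def[symmetric] vectorspace.basis_def[OF flag_ring_vectorspace]
    using tab_class_inj[OF n assms(3)] tab_class_independent[OF n assms(3) order_refl]
      tab_class_span[OF n assms(3)] tab_class_closed[OF n assms(3)] by blast
qed

end
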